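(* Let $\{x_j(h)\}_{j=1}^{N(h)}$ be a set of points in $\mathbf{R}^n$. Let $\mathcal{K}\subset T^*\mathbf{R}^n$ be a compact set. If $$\|f_h\|_{L^2}^2\le C\sum_{j=1}^{N(h)}|f_h(x_j(h))|^2+O(h^\infty)$$ for every semiclassically band limited $f_h$ with $\mathrm{WF}_h(f)\subset\mathcal{K}$, then $$N(h)\ge(2\pi h)^{-n}\operatorname{Vol}(\mathcal{K}^{\mathrm{int}})(1-o(h)),$$ where $\operatorname{Vol}(\mathcal{K}^{\mathrm{int}})=\int_{\mathcal{K}^{\mathrm{int}}}dx\,d\xi$ is the measure of the interior $\mathcal{K}^{\mathrm{int}}$ of $\mathcal{K}\subset T^*\mathbf{R}^n$.
   Context: Functions $f_h$ depend on a small parameter $h\in(0,h_0)$, and so do the finite set of points $x_j(h)$ and their number $N(h)$; $C>0$ is a constant. Set $\langle\xi\rangle=(1+|\xi|^2)^{1/2}$. $\mathcal{F}_hf(\xi)=\int e^{-\mathrm{i}x\cdot\xi/h}f(x)\,dx$; $\|f\|_{H_h^s}^2=(2\pi h)^{-n}\int\langle\xi\rangle^{2s}|\mathcal{F}_hf(\xi)|^2d\xi$; a family is tempered if $\|f_h\|_{H^s_h}=O(h^{-N})$ for some $s,N$. $\mathrm{WF}_h(f)\subset T^*\mathbf{R}^n$ is the complement of the set of $(x_0,\xi^0)$ for which there is $\phi\in C_0^\infty$, $\phi(x_0)\neq0$, with $\mathcal{F}_h(\phi f_h)(\xi)=O(h^\infty)$ for $\xi$ in a neighborhood of $\xi^0$.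 $f_h\in C_0^\infty(\mathbf{R}^n)$ is semiclassically band limited if (i) $\operatorname{supp}f_h$ lies in an $h$-independent compact set, (ii) $f_h$ is tempered, (iii) there is a compact set $\mathcal{B}\subset\mathbf{R}^n$ such that for every open $U\supset\mathcal{B}$ and every $N>0$, $|\mathcal{F}_hf(\xi)|\le C_Nh^N\langle\xi\rangle^{-N}$ for $\xi\notin U$. $O(h^\infty)$ denotes a quantity that is $O(h^N)$ as $h\to0$ for every $N$. *)

theory Defs
  imports "HOL-Analysis.Analysis" "HOL-Library.Landau_Symbols"
begin

text \<open>
  The parameter $h$ ranges over an interval \<open>{0<..<h0}\<close>, so an $h$-dependent family of functions
  on $\mathbf{R}^n$ is a function \<open>f :: real \<Rightarrow> real ^ 'n \<Rightarrow> complex\<close> whose values outside that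
  interval are irrelevant. Asymptotics as $h \to 0$ use the filter \<open>at_right 0\<close>. The cotangent
  bundle $T^*\mathbf{R}^n$ is the product \<open>(real ^ 'n) \<times> (real ^ 'n)\<close> of positions and covectors.
\<close>

primrec Ck :: "nat \<Rightarrow> ('a::euclidean_space \<Rightarrow> 'b::real_normed_vector) \<Rightarrow> bool" where
  "Ck 0 f \<longleftrightarrow> continuous_on UNIV f"
| "Ck (Suc k) f \<longleftrightarrow>
     (\<forall>x. f differentiable (at x)) \<and> (\<forall>v. Ck k (\<lambda>x. frechet_derivative f (at x) v))"

definition supp :: "('a::euclidean_space \<Rightarrow> 'b::real_normed_vector) \<Rightarrow> 'a set" where
  "supp f = closure {x. f x \<noteq> 0}"

text \<open>The space $C_0^\infty$ of smooth, compactly supported functions.\<close>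

definition test_function :: "('a::euclidean_space \<Rightarrow> 'b::real_normed_vector) \<Rightarrow> bool" where
  "test_function f \<longleftrightarrow> (\<forall>k. Ck k f) \<and> compact (supp f)"

definition japanese :: "'a::euclidean_space \<Rightarrow> real" where
  "japanese \<xi> = sqrt (1 + (norm \<xi>)\<^sup>2)"

definition fourier_h :: "real \<Rightarrow> (real ^ 'n \<Rightarrow> complex) \<Rightarrow> real ^ 'n \<Rightarrow> complex" where
  "fourier_h h f \<xi> =
     (\<integral>x. exp (- (\<i> * complex_of_real ((x \<bullet> \<xi>) / h))) * f x \<partial>lborel)"

definition L2_norm :: "(real ^ 'n \<Rightarrow> complex) \<Rightarrow> real" where
  "L2_norm f = sqrt (\<integral>x. (cmod (f x))\<^sup>2 \<partial>lborel)"

definition sobolev_norm_h :: "real \<Rightarrow> real \<Rightarrow> (real ^ 'n \<Rightarrow> complex) \<Rightarrow> real" where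
  "sobolev_norm_h h s f =
     sqrt (1 / (2 * pi * h) ^ CARD('n) *
       (\<integral>\<xi>. japanese \<xi> powr (2 * s) * (cmod (fourier_h h f \<xi>))\<^sup>2 \<partial>lborel))"

definition tempered :: "(real \<Rightarrow> real ^ 'n \<Rightarrow> complex) \<Rightarrow> bool" where
  "tempered f \<longleftrightarrow>
     (\<exists>s M. (\<lambda>h. sobolev_norm_h h s (f h)) \<in> O[at_right 0](\<lambda>h. h powr (- M)))"

definition O_h_infinity :: "(real \<Rightarrow> real) \<Rightarrow> bool" where
  "O_h_infinity r \<longleftrightarrow> (\<forall>M::nat. r \<in> O[at_right 0](\<lambda>h. h ^ M))"

text \<open>
  The estimate $O(h^\infty)$ for $\xi$ in a neighborhood \<open>V\<close> of $\xi^0$ is uniform over \<open>V\<close>,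
  and \<open>V\<close> does not depend on the order \<open>M\<close>.
\<close>

definition WF_h :: "(real \<Rightarrow> real ^ 'n \<Rightarrow> complex) \<Rightarrow> ((real ^ 'n) \<times> (real ^ 'n)) set" where
  "WF_h f = - {(x0, \<xi>0).
     \<exists>\<phi> :: real ^ 'n \<Rightarrow> complex. test_function \<phi> \<and> \<phi> x0 \<noteq> 0 \<and>
       (\<exists>V. open V \<and> \<xi>0 \<in> V \<and>
         (\<forall>M::nat. \<exists>B. \<forall>\<^sub>F h in at_right 0. \<forall>\<xi>\<in>V.
            cmod (fourier_h h (\<lambda>x. \<phi> x * f h x) \<xi>) \<le> B * h ^ M))}"

definition band_limited :: "real \<Rightarrow> (real \<Rightarrow> real ^ 'n \<Rightarrow> complex) \<Rightarrow> bool" where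
  "band_limited h0 f \<longleftrightarrow>
     (\<forall>h\<in>{0<..<h0}. test_function (f h)) \<and>
     (\<exists>S. compact S \<and> (\<forall>h\<in>{0<..<h0}. supp (f h) \<subseteq> S)) \<and>
     tempered f \<and>
     (\<exists>B. compact B \<and>
       (\<forall>U. open U \<and> B \<subseteq> U \<longrightarrow>
         (\<forall>M::nat. M > 0 \<longrightarrow>
           (\<exists>A. \<forall>h\<in>{0<..<h0}. \<forall>\<xi>. \<xi> \<notin> U \<longrightarrow>
              cmod (fourier_h h (f h) \<xi>) \<le> A * h ^ M * japanese \<xi> powr (- real M)))))"

end

theory Submission
  imports Defs "HOL-Computational_Algebra.Polynomial" "HOL-Probability.Sinc_Integral"
begin

text \<open>
  The lower bound is a dimension count. Write \<open>n\<close> for the dimension, \<open>V\<close> for the volume of the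
  interior of \<open>K\<close>, and suppose \<open>V > 0\<close>. If \<open>N(h) < V (2\<pi>h)\<^sup>-\<^sup>n\<close> for arbitrarily small \<open>h\<close>,
  then a space of functions microlocalized near \<open>K\<close> whose dimension exceeds \<open>N(h)\<close> contains a unit
  vector \<open>f\<close> vanishing at all the points \<open>x\<^sub>j(h)\<close>. Such functions, chosen along a sequence
  \<open>h \<rightarrow> 0\<close>, contradict the sampling inequality, which would read \<open>1 \<le> O(h\<^sup>\<infinity>)\<close>.

  The condition \<open>WF\<^sub>h(f) \<subseteq> K\<close> only concerns the limit \<open>h \<rightarrow> 0\<close>: it allows \<open>f\<^sub>h\<close> to be spread over
  a neighbourhood of \<open>K\<close> that shrinks to \<open>K\<close> arbitrarily slowly. A bounded open set containing
  the compact set \<open>K\<close> has strictly larger volume than the interior of \<open>K\<close>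
  (\<open>measure_interior_less_measure_open_superset\<close>). Hence there is room for more than
  \<open>V (2\<pi>h)\<^sup>-\<^sup>n\<close> independent functions, all error terms of the count are absorbed, and the bound
  holds for all small \<open>h\<close> without any loss; this is why a remainder as small as \<open>o(h)\<close> is possible.

  For a fixed bounded open set \<open>U\<close> of phase space the functions are explicit
  (\<open>microlocalized_functions_vanishing_on\<close>). Fill \<open>U\<close> from inside with products \<open>Q \<times> P\<close> of grid
  cubes of side \<open>l\<close>. For \<open>l' < l\<close> slightly smaller, take the wave packets
  \<open>\<phi>\<^sub>Q(x) exp(\<i> 2\<pi>m\<cdot>x/l')\<close>, where \<open>\<phi>\<^sub>Q\<close> is a smooth bump that is nonzero exactly in the interior of
  \<open>Q\<close> and the frequency \<open>2\<pi>hm/l'\<close> lies in a cube \<open>P\<close> with \<open>Q \<times> P \<subseteq> U\<close>. There are about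
  \<open>(l'l)\<^sup>n (2\<pi>h)\<^sup>-\<^sup>n\<close> of them for each product. The exponentials are orthogonal on the subcube of
  side \<open>l'\<close> in the middle of \<open>Q\<close>, where \<open>\<phi>\<^sub>Q\<close> is bounded below; so the coefficients of a unit
  vector are bounded uniformly in \<open>h\<close> (\<open>wave_packet_coefficient_bound\<close>). The
  semiclassical Fourier transform of a packet at distance \<open>d\<close> from its frequency is \<open>O((h/d)\<^sup>k)\<close>
  for every \<open>k\<close>, because \<open>\<phi>\<^sub>Q\<close> is smooth with compact support (\<open>fourier_decay\<close>), and the same
  is true after multiplication by a smooth cutoff. Bounded coefficients and
  \<open>O(h\<^sup>-\<^sup>n)\<close> packets then give the required decay of the whole sum.

  The constants in these estimates depend on \<open>U\<close>. A diagonal choice takes care of this: for the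
  neighbourhood of radius \<open>1/(j+1)\<close> the parameter \<open>h = H j\<close> is taken so small that the first \<open>j\<close>
  constants, for the first \<open>j\<close> members of a countable list of cutoffs, are at most \<open>1/h\<close>.
  Losing one power of \<open>h\<close> is harmless in \<open>O(h\<^sup>\<infinity>)\<close> bounds, and countably many cutoffs
  suffice to test the wave front set at every point outside \<open>K\<close>
  (locale \<open>concentrating_sequence\<close>).
\<close>

section \<open>Smooth functions and bumps\<close>

definition smooth :: "('a::euclidean_space \<Rightarrow> 'b::real_normed_vector) \<Rightarrow> bool" where
  "smooth f \<longleftrightarrow> (\<forall>k. Ck k f)"

lemma Ck_SucI:
  assumes "\<And>x. (f has_derivative f' x) (at x)" and "\<And>v. Ck k (\<lambda>x. f' x v)"
  shows "Ck (Suc k) f"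
proof -
  have "frechet_derivative f (at x) = f' x" for x
    using assms(1) frechet_derivative_at by metis
  then show ?thesis using assms by (auto simp: differentiable_def)
qed

lemma Ck_SucD:
  assumes "Ck (Suc k) f"
  shows "(f has_derivative frechet_derivative f (at x)) (at x)"
    and "Ck k (\<lambda>x. frechet_derivative f (at x) v)"
  using assms by (auto simp: frechet_derivative_works)

text \<open>
  The Leibniz rule for \<open>C\<^sup>k\<^sup>+\<^sup>1\<close> functions involves the undifferentiated factors, which the induction
  needs as \<open>C\<^sup>k\<close> functions.
\<close>

lemma Ck_mono_Suc: "Ck (Suc k) f \<Longrightarrow> Ck k f"
proof (induction k arbitrary: f)
  case 0
  then show ?case
    by (auto intro!: continuous_at_imp_continuous_on differentiable_imp_continuous_within)
next
  case (Suc k)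
  show ?case
    by (rule Ck_SucI[OF Ck_SucD(1)[OF Suc.prems]]) (rule Suc.IH[OF Ck_SucD(2)[OF Suc.prems]])
qed

lemma Ck_const: "Ck k (\<lambda>x. c)"
  by (induction k arbitrary: c) (auto intro!: Ck_SucI derivative_eq_intros simp del: Ck.simps(2))

lemma Ck_add:
  "Ck k f \<Longrightarrow> Ck k g \<Longrightarrow> Ck k (\<lambda>x. f x + g x)"
proof (induction k arbitrary: f g)
  case 0
  then show ?case by (auto intro: continuous_on_add)
next
  case (Suc k)
  show ?case
    by (rule Ck_SucI[OF has_derivative_add[OF Ck_SucD(1)[OF Suc.prems(1)] Ck_SucD(1)[OF Suc.prems(2)]]])
      (intro Suc.IH Ck_SucD(2) Suc.prems)
qed

lemma Ck_mult:
  fixes f g :: "'a::euclidean_space \<Rightarrow> 'b::real_normed_field"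
  shows "Ck k f \<Longrightarrow> Ck k g \<Longrightarrow> Ck k (\<lambda>x. f x * g x)"
proof (induction k arbitrary: f g)
  case 0
  then show ?case by (auto intro: continuous_on_mult)
next
  case (Suc k)
  show ?case
    by (rule Ck_SucI[OF has_derivative_mult[OF Ck_SucD(1)[OF Suc.prems(1)] Ck_SucD(1)[OF Suc.prems(2)]]])
      (intro Ck_add Suc.IH Ck_SucD(2) Suc.prems Ck_mono_Suc)
qed

lemma smooth_const [simp]: "smooth (\<lambda>x. c)"
  by (simp add: smooth_def Ck_const)

lemma smooth_mult:
  fixes f g :: "'a::euclidean_space \<Rightarrow> 'b::real_normed_field"
  shows "smooth f \<Longrightarrow> smooth g \<Longrightarrow> smooth (\<lambda>x. f x * g x)"
  by (simp add: smooth_def Ck_mult)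

lemma smooth_sum: "(\<And>i. i \<in> I \<Longrightarrow> smooth (f i)) \<Longrightarrow> smooth (\<lambda>x. \<Sum>i\<in>I. f i x)"
  by (induction I rule: infinite_finite_induct) (auto simp: smooth_def Ck_const intro!: Ck_add)

lemma smooth_prod:
  fixes f :: "'i \<Rightarrow> 'a::euclidean_space \<Rightarrow> 'b::real_normed_field"
  shows "(\<And>i. i \<in> I \<Longrightarrow> smooth (f i)) \<Longrightarrow> smooth (\<lambda>x. \<Prod>i\<in>I. f i x)"
  by (induction I rule: infinite_finite_induct) (auto simp: smooth_def Ck_const intro!: Ck_mult)

lemma smooth_exp_inner:
  fixes z :: "'a::euclidean_space"
  shows "smooth (\<lambda>x. exp (\<i> * complex_of_real (x \<bullet> z)))"
proof -
  have "Ck k (\<lambda>x. c * exp (\<i> * complex_of_real (x \<bullet> z)))" for k c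
  proof (induction k arbitrary: c)
    case 0
    then show ?case by (auto intro!: continuous_intros)
  next
    case (Suc k)
    have "((\<lambda>x. exp (\<i> * complex_of_real (x \<bullet> z))) has_derivative
        (\<lambda>v. exp (\<i> * complex_of_real (x \<bullet> z)) * (\<i> * complex_of_real (v \<bullet> z)))) (at x)" for x
      by (rule has_derivative_compose[of "\<lambda>x. \<i> * complex_of_real (x \<bullet> z)" _ x UNIV exp,
            OF _ DERIV_exp[unfolded has_field_derivative_def]])
        (auto intro!: derivative_eq_intros)
    then have der: "((\<lambda>x. c * exp (\<i> * complex_of_real (x \<bullet> z))) has_derivative
        (\<lambda>v. (c * \<i> * complex_of_real (v \<bullet> z)) * exp (\<i> * complex_of_real (x \<bullet> z)))) (at x)" for x
      by (auto intro!: derivative_eq_intros simp: algebra_simps)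
    show ?case by (rule Ck_SucI[OF der]) (rule Suc.IH)
  qed
  from this[of _ 1] show ?thesis by (simp add: smooth_def)
qed

lemma smooth_imp_continuous: "smooth f \<Longrightarrow> continuous_on UNIV f"
  unfolding smooth_def by (drule spec[of _ 0]) simp

text \<open>
  For \<open>p = 1\<close> this is the standard flat function \<open>exp (-1/t)\<close> on the positive half-line. Polynomial
  factors in \<open>1/t\<close> are carried along so that the class of these functions is closed under
  differentiation.
\<close>

definition flat :: "real poly \<Rightarrow> real \<Rightarrow> real" where
  "flat p t = (if t > 0 then poly p (1 / t) * exp (- (1 / t)) else 0)"

lemma poly_times_exp_tendsto_0:
  fixes p :: "real poly"
  shows "((\<lambda>y. poly p y * exp (- y)) \<longlongrightarrow> 0) at_top"
proof -
  have "((\<lambda>y. \<Sum>i\<le>degree p. coeff p i * (y ^ i / exp y)) \<longlongrightarrow> (\<Sum>i\<le>degree p. coeff p i * 0)) at_top"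
    by (intro tendsto_intros tendsto_power_div_exp_0)
  also have "(\<lambda>y. \<Sum>i\<le>degree p. coeff p i * (y ^ i / exp y)) = (\<lambda>y. poly p y * exp (- y))"
    by (simp add: poly_altdef sum_distrib_right sum_divide_distrib exp_minus field_simps)
  finally show ?thesis by simp
qed

text \<open>At \<open>0\<close> from the right this is the decay of \<open>p(y) exp(-y)\<close> at infinity, with \<open>y = 1/t\<close>.\<close>

lemma flat_tendsto_0: "(flat p \<longlongrightarrow> 0) (at 0)"
proof -
  have "((\<lambda>t. poly p (1 / t) * exp (- (1 / t))) \<longlongrightarrow> 0) (at_right 0)"
    using filterlim_compose[OF poly_times_exp_tendsto_0 filterlim_inverse_at_top_right]
    by (simp add: inverse_eq_divide)
  moreover have "\<forall>\<^sub>F t in at_right 0. poly p (1 / t) * exp (- (1 / t)) = flat p t"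
    by (auto simp: flat_def eventually_at_right_less intro: eventually_mono[OF eventually_at_right_less])
  ultimately have right: "(flat p \<longlongrightarrow> 0) (at_right 0)"
    by (rule Lim_transform_eventually)
  have "\<forall>\<^sub>F t in at_left 0. 0 = flat p t"
    by (auto simp: flat_def eventually_at_filter)
  then have "(flat p \<longlongrightarrow> 0) (at_left 0)"
    by (rule Lim_transform_eventually[OF tendsto_const])
  then show ?thesis using right by (rule filterlim_split_at)
qed

text \<open>
  Away from \<open>0\<close> this is the chain rule with \<open>(1/t)' = - (1/t)\<^sup>2\<close>. At \<open>0\<close> the difference quotient of
  \<open>flat p\<close> is itself the flat function for the polynomial \<open>y p(y)\<close>, which tends to \<open>0\<close>.
\<close>

lemma flat_has_real_derivative:
  "(flat p has_real_derivative flat (monom 1 2 * (p - pderiv p)) t) (at t)"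
proof -
  consider "t > 0" | "t < 0" | "t = 0" by linarith
  then show ?thesis
  proof cases
    case 1
    have "((\<lambda>t. poly p (1 / t) * exp (- (1 / t))) has_real_derivative
        flat (monom 1 2 * (p - pderiv p)) t) (at t)"
      using 1 by (auto intro!: derivative_eq_intros simp: flat_def poly_monom field_simps power2_eq_square)
    then show ?thesis
      by (rule DERIV_cong_ev[THEN iffD1, rotated 3])
        (use 1 eventually_nhds_in_open[of "{0<..}" t] in \<open>auto simp: flat_def elim!: eventually_mono\<close>)
  next
    case 2
    have "((\<lambda>t. 0) has_real_derivative flat (monom 1 2 * (p - pderiv p)) t) (at t)"
      using 2 by (simp add: flat_def)
    then show ?thesis
      by (rule DERIV_cong_ev[THEN iffD1, rotated 3])
        (use 2 eventually_nhds_in_open[of "{..<0}" t] in \<open>auto simp: flat_def elim!: eventually_mono\<close>)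
  next
    case 3
    have "\<forall>\<^sub>F t in at 0. flat (pCons 0 p) t = (flat p (0 + t) - flat p 0) / t"
      by (auto simp: flat_def eventually_at_filter)
    then have "((\<lambda>t. (flat p (0 + t) - flat p 0) / t) \<longlongrightarrow> 0) (at 0)"
      by (rule Lim_transform_eventually[OF flat_tendsto_0])
    then show ?thesis using 3 by (simp add: DERIV_def flat_def)
  qed
qed

text \<open>
  Each derivative of such a function is a constant multiple of a function of the same form, for
  another polynomial; this makes the induction on the order of differentiability work.
\<close>

lemma smooth_flat_inner:
  fixes v :: "'a::euclidean_space"
  shows "smooth (\<lambda>x. complex_of_real (flat p (x \<bullet> v + s)))"
proof -
  have "Ck k (\<lambda>x. c * complex_of_real (flat p (x \<bullet> v + s)))" for k c p
  proof (induction k arbitrary: c p)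
    case 0
    have "continuous_on UNIV (flat p)"
      using flat_has_real_derivative DERIV_isCont continuous_at_imp_continuous_on by blast
    then show ?case
      by (auto intro!: continuous_intros intro: continuous_on_compose2[of UNIV "flat p"])
  next
    case (Suc k)
    let ?q = "monom 1 2 * (p - pderiv p)"
    have "((\<lambda>x. flat p (x \<bullet> v + s)) has_derivative
        (\<lambda>w. flat ?q (x \<bullet> v + s) * (w \<bullet> v))) (at x)" for x
      by (rule has_derivative_compose[of "\<lambda>x. x \<bullet> v + s" "\<lambda>w. w \<bullet> v" x UNIV "flat p",
            OF _ flat_has_real_derivative[unfolded has_field_derivative_def]])
        (auto intro!: derivative_eq_intros)
    then have der: "((\<lambda>x. c * complex_of_real (flat p (x \<bullet> v + s))) has_derivative
        (\<lambda>w. (c * complex_of_real (w \<bullet> v)) * complex_of_real (flat ?q (x \<bullet> v + s)))) (at x)" for x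
      by (auto intro!: derivative_eq_intros simp: algebra_simps)
    show ?case by (rule Ck_SucI[OF der]) (rule Suc.IH)
  qed
  from this[of _ 1] show ?thesis by (simp add: smooth_def)
qed

text \<open>
  A product of one-variable factors, so that it is smooth and does not vanish anywhere in the
  open box.
\<close>

definition bump :: "real ^ 'n \<Rightarrow> real ^ 'n \<Rightarrow> real ^ 'n \<Rightarrow> complex" where
  "bump a b x = (\<Prod>i\<in>UNIV. complex_of_real (flat 1 (x $ i - a $ i)) * complex_of_real (flat 1 (b $ i - x $ i)))"

lemma smooth_bump:
  fixes a b :: "real ^ 'n"
  shows "smooth (bump a b)"
proof -
  have 1: "smooth (\<lambda>x::real^'n. complex_of_real (flat 1 (x $ i - a $ i)))" for i
    using smooth_flat_inner[of 1 "axis i 1 :: real ^ 'n" "- (a $ i)"] by (simp add: inner_axis)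
  have 2: "smooth (\<lambda>x::real^'n. complex_of_real (flat 1 (b $ i - x $ i)))" for i
    using smooth_flat_inner[of 1 "- axis i 1 :: real ^ 'n" "b $ i"] by (simp add: inner_axis)
  show ?thesis unfolding bump_def[abs_def] by (intro smooth_prod smooth_mult 1 2)
qed

lemma bump_eq_0_iff: "bump a b x = 0 \<longleftrightarrow> x \<notin> box a b"
proof -
  have "bump a b x \<noteq> 0 \<longleftrightarrow> x \<in> box a b"
    by (simp add: bump_def flat_def mem_box_cart) blast
  then show ?thesis by blast
qed

text \<open>
  The flat function for \<open>p = 1\<close> is increasing, and at points of distance at least \<open>\<rho>\<close> from the faces
  of the box it is evaluated only at arguments at least \<open>\<rho>\<close>, \<open>2n\<close> times.
\<close>

lemma bump_lower_bound:
  fixes a b x :: "real ^ 'n"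
  assumes "\<rho> > 0" and "\<And>i. a $ i + \<rho> \<le> x $ i \<and> x $ i + \<rho> \<le> b $ i"
  shows "exp (- (1 / \<rho>)) ^ (2 * CARD('n)) \<le> cmod (bump a b x)"
proof -
  have mono: "exp (- (1 / \<rho>)) \<le> flat 1 t" if "\<rho> \<le> t" for t
    using that assms(1) by (simp add: flat_def frac_le)
  have "(\<Prod>i\<in>(UNIV::'n set). exp (- (1 / \<rho>)) * exp (- (1 / \<rho>)))
      \<le> (\<Prod>i\<in>UNIV. flat 1 (x $ i - a $ i) * flat 1 (b $ i - x $ i))"
    using assms(2) by (intro prod_mono conjI mult_mono mono) (auto simp: algebra_simps flat_def)
  also have "\<dots> = cmod (bump a b x)"
    by (simp add: bump_def norm_mult flat_def flip: prod_norm)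
  finally show ?thesis by (simp add: power_mult power2_eq_square)
qed

section \<open>Rapid decay of the Fourier transform\<close>

lemma test_function_iff: "test_function f \<longleftrightarrow> smooth f \<and> compact (supp f)"
  by (simp add: test_function_def smooth_def)

lemma not_in_supp: "x \<notin> supp f \<Longrightarrow> f x = 0"
  using closure_subset[of "{x. f x \<noteq> 0}"] by (auto simp: supp_def)

lemma compact_suppI:
  assumes "compact S" and "\<And>x. x \<notin> S \<Longrightarrow> f x = 0"
  shows "compact (supp f)" and "supp f \<subseteq> S"
proof -
  show sub: "supp f \<subseteq> S"
    unfolding supp_def using assms by (intro closure_minimal compact_imp_closed) auto
  then show "compact (supp f)"
    using assms(1) compact_Int_closed[of S "supp f"] by (simp add: supp_def inf_absorb2)
qed

lemma integrable_compact_supp: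
  fixes f :: "'a::euclidean_space \<Rightarrow> 'b::{banach, second_countable_topology}"
  assumes "continuous_on UNIV f" and "compact S" and "\<And>x. x \<notin> S \<Longrightarrow> f x = 0"
  shows "integrable lborel f"
proof -
  have "integrable lborel (\<lambda>x. indicator S x *\<^sub>R f x)"
    using assms by (intro borel_integrable_compact) (auto intro: continuous_on_subset)
  also have "(\<lambda>x. indicator S x *\<^sub>R f x) = f"
    using assms(3) by (auto simp: indicator_def fun_eq_iff)
  finally show ?thesis .
qed

lemma test_function_integrable:
  fixes f :: "'a::euclidean_space \<Rightarrow> complex"
  assumes "test_function f"
  shows "integrable lborel f"
  using assms integrable_compact_supp[of f "supp f"]
  by (auto simp: test_function_iff smooth_imp_continuous not_in_supp)

lemma test_function_smooth_mult:
  fixes f g :: "'a::euclidean_space \<Rightarrow> complex"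
  assumes "smooth f" and "test_function g"
  shows "test_function (\<lambda>x. f x * g x)"
  using assms compact_suppI(1)[of "supp g" "\<lambda>x. f x * g x"]
  by (auto simp: test_function_iff smooth_mult not_in_supp)

lemma smooth_directional_derivative:
  "smooth f \<Longrightarrow> smooth (\<lambda>x. frechet_derivative f (at x) v)"
  unfolding smooth_def by (metis Ck_SucD(2))

lemma smooth_has_derivative:
  "smooth f \<Longrightarrow> (f has_derivative frechet_derivative f (at x)) (at x)"
  unfolding smooth_def by (metis Ck_SucD(1))

lemma test_function_directional_derivative:
  assumes "test_function f"
  shows "test_function (\<lambda>x. frechet_derivative f (at x) v)"
proof -
  have "frechet_derivative f (at x) v = 0" if "x \<notin> supp f" for x
  proof -
    have "open (- supp f)" by (simp add: supp_def open_Compl)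
    then have "(f has_derivative (\<lambda>v. 0)) (at x)"
      using that
      by (intro has_derivative_transform_within_open[of "\<lambda>x. 0" _ x UNIV "- supp f" f] has_derivative_const)
        (auto simp: not_in_supp)
    then have "frechet_derivative f (at x) = (\<lambda>v. 0)"
      using frechet_derivative_at by metis
    then show ?thesis by simp
  qed
  then have "compact (supp (\<lambda>x. frechet_derivative f (at x) v))"
    using assms compact_suppI(1)[of "supp f" "\<lambda>x. frechet_derivative f (at x) v"]
    by (auto simp: test_function_iff)
  with assms show ?thesis by (simp add: test_function_iff smooth_directional_derivative)
qed

text \<open>
  By translation invariance \<open>\<integral> f(x + tv) dx\<close> does not depend on \<open>t\<close>; its derivative at \<open>t = 0\<close>, taken
  under the integral sign, is the integral of the directional derivative. This replaces integration
  by parts, without iterated integrals.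
\<close>

lemma integral_directional_derivative_eq_0:
  fixes f :: "'a::euclidean_space \<Rightarrow> complex"
  assumes "test_function f"
  shows "(\<integral>x. frechet_derivative f (at x) v \<partial>lborel) = 0"
proof -
  define D where "D = (\<lambda>x. frechet_derivative f (at x) v)"
  have f: "smooth f" "compact (supp f)" and D: "test_function D"
    using assms test_function_directional_derivative by (auto simp: D_def test_function_iff)
  obtain R where R: "\<And>x. x \<in> supp f \<union> supp D \<Longrightarrow> norm x \<le> R"
    using f D by (metis bounded_Un bounded_iff compact_imp_bounded test_function_iff)
  (* A box so large that it contains the support of every translate by t v with |t| < 1: only
     integrals over one fixed compact box can be differentiated below. *)
  obtain b where "cball 0 (R + norm v) \<subseteq> cbox (- b) (b :: 'a)"
    using bounded_subset_cbox_symmetric[of "cball 0 (R + norm v)"] by auto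
  then have b: "x \<in> cbox (- b) b" if "norm x \<le> R + norm v" for x
    using that by auto
  have cont: "continuous_on UNIV f" "continuous_on UNIV D"
    using f D by (auto simp: test_function_iff smooth_imp_continuous)
  have int: "integral (cbox (- b) b) g = (\<integral>x. g x \<partial>lborel)"
    if "continuous_on UNIV g" and "\<And>x. g x \<noteq> 0 \<Longrightarrow> norm x \<le> R + norm v" for g :: "'a \<Rightarrow> complex"
  proof -
    have "integrable lborel g"
      using that b by (intro integrable_compact_supp[of g "cbox (- b) b"]) (auto intro: compact_cbox)
    then have "(\<integral>x. g x \<partial>lborel) = integral UNIV g" by (simp add: integral_lborel)
    also have "\<dots> = integral (cbox (- b) b) g"
      using that b by (intro integral_spike_set) (auto intro!: empty_imp_negligible)
    finally show ?thesis ..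
  qed
  define U :: "real set" where "U = {-1<..<1}"
  have const: "integral (cbox (- b) b) (\<lambda>x. f (x + t *\<^sub>R v)) = (\<integral>x. f x \<partial>lborel)" if "t \<in> U" for t
  proof -
    have "norm x \<le> R + norm v" if "f (x + t *\<^sub>R v) \<noteq> 0" for x
    proof -
      have "norm (x + t *\<^sub>R v) \<le> R" using that R not_in_supp by blast
      moreover have "norm (t *\<^sub>R v) \<le> norm v"
        using \<open>t \<in> U\<close> by (auto simp: U_def intro: mult_left_le_one_le)
      moreover have "norm x \<le> norm (x + t *\<^sub>R v) + norm (t *\<^sub>R v)"
        using norm_triangle_ineq4[of "x + t *\<^sub>R v" "t *\<^sub>R v"] by simp
      ultimately show ?thesis by linarith
    qed
    then have "integral (cbox (- b) b) (\<lambda>x. f (x + t *\<^sub>R v)) = (\<integral>x. f (x + t *\<^sub>R v) \<partial>lborel)"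
      by (intro int continuous_on_compose2[OF cont(1)] continuous_intros) auto
    also have "\<dots> = (\<integral>x. f x \<partial>distr lborel borel ((+) (t *\<^sub>R v)))"
      by (subst integral_distr)
        (auto simp: add.commute intro!: borel_measurable_continuous_onI cont)
    finally show ?thesis by (simp only: lborel_distr_plus)
  qed
  have "((\<lambda>t. integral (cbox (- b) b) (\<lambda>x. f (x + t *\<^sub>R v))) has_vector_derivative
      integral (cbox (- b) b) (\<lambda>x. D (x + 0 *\<^sub>R v))) (at 0 within U)"
  proof (rule leibniz_rule_vector_derivative)
    fix t x
    have "((\<lambda>t. f (x + t *\<^sub>R v)) has_derivative (\<lambda>s. frechet_derivative f (at (x + t *\<^sub>R v)) (s *\<^sub>R v)))
        (at t within U)"
      by (rule has_derivative_compose[OF _ smooth_has_derivative[OF f(1)]])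
        (auto intro!: derivative_eq_intros)
    moreover have "frechet_derivative f (at y) (s *\<^sub>R v) = s *\<^sub>R D y" for s y
      using has_derivative_bounded_linear[OF smooth_has_derivative[OF f(1), of y]]
      by (simp add: D_def linear_simps)
    ultimately show "((\<lambda>t. f (x + t *\<^sub>R v)) has_vector_derivative D (x + t *\<^sub>R v)) (at t within U)"
      by (simp add: has_vector_derivative_def)
  next
    fix t
    show "(\<lambda>x. f (x + t *\<^sub>R v)) integrable_on cbox (- b) b"
      by (intro integrable_continuous continuous_on_compose2[OF cont(1)] continuous_intros) auto
  next
    have "continuous_on (U \<times> cbox (- b) b) (\<lambda>p. D (snd p + fst p *\<^sub>R v))"
      by (intro continuous_on_compose2[OF cont(2)] continuous_intros) auto
    then show "continuous_on (U \<times> cbox (- b) b) (\<lambda>(t, x). D (x + t *\<^sub>R v))"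
      by (simp add: case_prod_unfold)
  qed (auto simp: U_def)
  moreover have "((\<lambda>t. integral (cbox (- b) b) (\<lambda>x. f (x + t *\<^sub>R v))) has_vector_derivative 0) (at 0 within U)"
    by (rule has_vector_derivative_transform[OF _ _ has_vector_derivative_const])
      (auto simp: const, simp add: U_def)
  ultimately have "integral (cbox (- b) b) D = 0"
    by (simp add: U_def at_within_open[of 0 "{-1<..<1}"] vector_derivative_unique_at)
  moreover have "integral (cbox (- b) b) D = (\<integral>x. D x \<partial>lborel)"
  proof (intro int cont)
    fix x assume "D x \<noteq> 0"
    then have "norm x \<le> R" using R[of x] not_in_supp[of x D] by auto
    then show "norm x \<le> R + norm v" by (simp add: add_increasing2)
  qed
  ultimately show ?thesis by (simp add: D_def)
qed

text \<open>The transform \<open>fourier_h\<close> at \<open>h = 1\<close>, to which every \<open>h\<close> reduces by scaling the frequency.\<close>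

definition fourier :: "('a::euclidean_space \<Rightarrow> complex) \<Rightarrow> 'a \<Rightarrow> complex" where
  "fourier f z = (\<integral>x. exp (- (\<i> * complex_of_real (x \<bullet> z))) * f x \<partial>lborel)"

lemma norm_fourier_le: "cmod (fourier f z) \<le> (\<integral>x. cmod (f x) \<partial>lborel)"
  unfolding fourier_def by (rule order_trans[OF integral_norm_bound]) (simp add: norm_mult)

lemma smooth_exp_minus_inner: "smooth (\<lambda>x. exp (- (\<i> * complex_of_real (x \<bullet> z))))"
  using smooth_exp_inner[of "- z"] by simp

text \<open>
  The integral of the derivative of \<open>exp(-\<i> x\<cdot>z) f(x)\<close> in direction \<open>v\<close> vanishes, and the product
  rule splits it into the two sides.
\<close>

lemma fourier_directional_derivative:
  fixes f :: "'a::euclidean_space \<Rightarrow> complex"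
  assumes "test_function f"
  shows "fourier (\<lambda>x. frechet_derivative f (at x) v) z = \<i> * complex_of_real (v \<bullet> z) * fourier f z"
proof -
  define e where "e = (\<lambda>x. exp (- (\<i> * complex_of_real (x \<bullet> z))))"
  define D where "D = (\<lambda>x. frechet_derivative f (at x) v)"
  have e: "smooth e" unfolding e_def by (rule smooth_exp_minus_inner)
  have ef: "test_function (\<lambda>x. e x * f x)" and eD: "test_function (\<lambda>x. e x * D x)"
    using assms e by (auto simp: D_def intro!: test_function_smooth_mult test_function_directional_derivative)
  have de: "(e has_derivative (\<lambda>w. e x * - (\<i> * complex_of_real (w \<bullet> z)))) (at x)" for x
    unfolding e_def
    by (rule has_derivative_compose[of "\<lambda>x. - (\<i> * complex_of_real (x \<bullet> z))" _ x UNIV exp,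
          OF _ DERIV_exp[unfolded has_field_derivative_def]])
      (auto intro!: derivative_eq_intros)
  have "frechet_derivative (\<lambda>x. e x * f x) (at x) v = e x * D x - \<i> * complex_of_real (v \<bullet> z) * (e x * f x)" for x
    using fun_cong[OF frechet_derivative_at[OF has_derivative_mult[OF de[of x] smooth_has_derivative[of f x]]], of v] assms
    by (simp add: test_function_iff D_def algebra_simps)
  then have "0 = (\<integral>x. e x * D x - \<i> * complex_of_real (v \<bullet> z) * (e x * f x) \<partial>lborel)"
    using integral_directional_derivative_eq_0[OF ef, of v] by simp
  also have "\<dots> = fourier D z - \<i> * complex_of_real (v \<bullet> z) * fourier f z"
    using test_function_integrable[OF ef] test_function_integrable[OF eD]
    by (simp add: fourier_def e_def)
  finally show ?thesis by (simp add: D_def)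
qed

text \<open>
  Bounding \<open>|z|\<close> by the sum of the \<open>|z \<cdot> b|\<close> over the basis trades each factor \<open>|z|\<close> for one
  directional derivative of \<open>f\<close>, which is again a test function.
\<close>

lemma fourier_decay:
  fixes f :: "'a::euclidean_space \<Rightarrow> complex"
  assumes "test_function f"
  obtains G where "G \<ge> 0" and "\<And>z. norm z ^ M * cmod (fourier f z) \<le> G"
proof -
  have "\<exists>G\<ge>0. \<forall>z. norm z ^ M * cmod (fourier f z) \<le> G"
    using assms
  proof (induction M arbitrary: f)
    case 0
    show ?case by (rule exI[of _ "\<integral>x. cmod (f x) \<partial>lborel"]) (simp add: norm_fourier_le)
  next
    case (Suc M)
    have "\<forall>b. \<exists>G\<ge>0. \<forall>z. norm z ^ M * cmod (fourier (\<lambda>x. frechet_derivative f (at x) b) z) \<le> G"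
      using Suc by (blast intro: test_function_directional_derivative)
    then obtain G where G: "\<And>b. G b \<ge> 0"
      "\<And>b z. norm z ^ M * cmod (fourier (\<lambda>x. frechet_derivative f (at x) b) z) \<le> G b"
      by metis
    have "norm z ^ Suc M * cmod (fourier f z) \<le> (\<Sum>b\<in>Basis. G b)" for z
    proof -
      have "norm z ^ Suc M * cmod (fourier f z) \<le> (\<Sum>b\<in>Basis. \<bar>z \<bullet> b\<bar>) * (norm z ^ M * cmod (fourier f z))"
        using mult_right_mono[OF norm_le_l1[of z], of "norm z ^ M * cmod (fourier f z)"] by (simp add: mult_ac)
      also have "\<dots> = (\<Sum>b\<in>Basis. norm z ^ M * cmod (fourier (\<lambda>x. frechet_derivative f (at x) b) z))"
        unfolding sum_distrib_right using Suc.prems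
        by (intro sum.cong refl)
          (simp add: fourier_directional_derivative norm_mult inner_commute[of z])
      also have "\<dots> \<le> (\<Sum>b\<in>Basis. G b)" by (intro sum_mono G)
      finally show ?thesis .
    qed
    then show ?case using G(1) by (intro exI[of _ "sum G Basis"]) (auto intro!: sum_nonneg)
  qed
  then show ?thesis using that by blast
qed

lemma fourier_h_eq: "fourier_h h f \<xi> = fourier f (\<xi> /\<^sub>R h)"
  by (simp add: fourier_h_def fourier_def divide_inverse mult.commute)

section \<open>Integrals of products of one-variable functions\<close>

text \<open>
  Fubini's theorem, since Lebesgue measure is the image of a product measure under the map from
  coordinates to vectors.
\<close>

lemma lborel_integral_prod_Basis:
  fixes f :: "'a::euclidean_space \<Rightarrow> real \<Rightarrow> 'b::{real_normed_field, banach, second_countable_topology}"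
  assumes int: "\<And>b. b \<in> Basis \<Longrightarrow> integrable lborel (f b)"
  shows "integrable lborel (\<lambda>x. \<Prod>b\<in>Basis. f b (x \<bullet> b))"
    and "(\<integral>x. (\<Prod>b\<in>Basis. f b (x \<bullet> b)) \<partial>lborel) = (\<Prod>b\<in>Basis. \<integral>t. f b t \<partial>lborel)"
proof -
  interpret product_sigma_finite "\<lambda>_::'a. lborel :: real measure"
    by unfold_locales
  have [measurable]: "f b \<in> borel_measurable borel" if "b \<in> Basis" for b
    using int[OF that] by (auto dest: borel_measurable_integrable)
  have meas: "(\<lambda>x. \<Prod>b\<in>Basis. f b (x \<bullet> b)) \<in> borel_measurable borel"
    by (intro borel_measurable_prod) measurable
  have T: "(\<lambda>g. \<Sum>b\<in>Basis. g b *\<^sub>R b) \<in> (\<Pi>\<^sub>M b\<in>Basis. lborel) \<rightarrow>\<^sub>M (borel :: 'a measure)"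
    by measurable
  have eq: "(\<Prod>b\<in>Basis. f b ((\<Sum>b\<in>Basis. g b *\<^sub>R b) \<bullet> b)) = (\<Prod>b\<in>Basis. f b (g b))" for g
    by (intro prod.cong refl) simp
  show "integrable lborel (\<lambda>x. \<Prod>b\<in>Basis. f b (x \<bullet> b))"
    by (subst lborel_eq, subst integrable_distr_eq[OF T meas], subst eq)
      (intro product_integrable_prod int finite_Basis)
  show "(\<integral>x. (\<Prod>b\<in>Basis. f b (x \<bullet> b)) \<partial>lborel) = (\<Prod>b\<in>Basis. \<integral>t. f b t \<partial>lborel)"
    by (subst lborel_eq, subst integral_distr[OF T meas], subst eq)
      (intro product_integral_prod int finite_Basis)
qed

lemma lborel_integral_prod_vec:
  fixes f :: "'n::finite \<Rightarrow> real \<Rightarrow> 'b::{real_normed_field, banach, second_countable_topology}"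
  assumes int: "\<And>i. integrable lborel (f i)"
  shows "integrable lborel (\<lambda>x::real^'n. \<Prod>i\<in>UNIV. f i (x $ i))"
    and "(\<integral>x. (\<Prod>i\<in>UNIV. f i (x $ i)) \<partial>(lborel :: (real ^ 'n) measure)) = (\<Prod>i\<in>UNIV. \<integral>t. f i t \<partial>lborel)"
proof -
  define e :: "'n \<Rightarrow> real ^ 'n" where "e = (\<lambda>i. axis i 1)"
  have inj: "inj e"
    by (auto simp: e_def inj_def axis_eq_axis)
  have Basis: "(Basis :: (real ^ 'n) set) = range e"
    by (auto simp: Basis_vec_def e_def)
  define g where "g = (\<lambda>b. f (inv e b))"
  have reindex: "(\<Prod>b\<in>Basis. F (inv e b) b) = (\<Prod>i\<in>UNIV. F i (e i))" for F :: "'n \<Rightarrow> real ^ 'n \<Rightarrow> 'b"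
    using inj by (simp add: Basis prod.reindex)
  have 1: "(\<Prod>b\<in>Basis. g b (x \<bullet> b)) = (\<Prod>i\<in>UNIV. f i (x $ i))" for x :: "real ^ 'n"
    using reindex[of "\<lambda>i b. f i (x \<bullet> b)"] by (simp add: g_def e_def inner_axis)
  have 2: "(\<Prod>b\<in>Basis. \<integral>t. g b t \<partial>lborel) = (\<Prod>i\<in>UNIV. \<integral>t. f i t \<partial>lborel)"
    using reindex[of "\<lambda>i b. \<integral>t. f i t \<partial>lborel"] by (simp add: g_def)
  have int_g: "integrable lborel (g b)" for b by (simp add: g_def int)
  show "integrable lborel (\<lambda>x::real^'n. \<Prod>i\<in>UNIV. f i (x $ i))"
    using lborel_integral_prod_Basis(1)[of g, OF int_g] by (simp only: 1)
  show "(\<integral>x. (\<Prod>i\<in>UNIV. f i (x $ i)) \<partial>(lborel :: (real ^ 'n) measure)) = (\<Prod>i\<in>UNIV. \<integral>t. f i t \<partial>lborel)"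
    using lborel_integral_prod_Basis(2)[of g, OF int_g] by (simp only: 1 2)
qed

lemma integral_cbox_prod:
  fixes f :: "'n::finite \<Rightarrow> real \<Rightarrow> complex" and a b :: "real ^ 'n"
  assumes "\<And>i. continuous_on UNIV (f i)"
  shows "(\<integral>x. indicator (cbox a b) x *\<^sub>R (\<Prod>i\<in>UNIV. f i (x $ i)) \<partial>lborel)
    = (\<Prod>i\<in>UNIV. integral {a $ i..b $ i} (f i))"
proof -
  have int: "integrable lborel (\<lambda>t. indicator {a $ i..b $ i} t *\<^sub>R f i t)" for i
    using assms by (intro borel_integrable_compact) (auto intro: continuous_on_subset)
  have "indicator (cbox a b) x *\<^sub>R (\<Prod>i\<in>UNIV. f i (x $ i))
      = (\<Prod>i\<in>UNIV. indicator {a $ i..b $ i} (x $ i) *\<^sub>R f i (x $ i))" for x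
    by (simp add: scaleR_conv_of_real prod.distrib indicator_def mem_box_cart)
  moreover have "(\<integral>t. indicator {a $ i..b $ i} t *\<^sub>R f i t \<partial>lborel) = integral {a $ i..b $ i} (f i)" for i
    using set_borel_integral_eq_integral(2)[of "{a $ i..b $ i}" "f i"] int[of i]
    by (simp add: set_integrable_def set_lebesgue_integral_def)
  ultimately show ?thesis
    using lborel_integral_prod_vec(2)[of "\<lambda>i t. indicator {a $ i..b $ i} t *\<^sub>R f i t", OF int] by simp
qed

lemma integral_exp_period:
  fixes k :: int
  assumes "l > 0"
  shows "integral {s..s + l} (\<lambda>t. exp (\<i> * complex_of_real (2 * pi * k / l * t)))
    = (if k = 0 then complex_of_real l else 0)"
proof (cases "k = 0")
  case True
  then show ?thesis using assms by (simp add: scaleR_conv_of_real)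
next
  case False
  define w where "w = \<i> * complex_of_real (2 * pi * k / l)"
  have w: "w \<noteq> 0" using False assms by (simp add: w_def)
  have "((\<lambda>t. exp (w * complex_of_real t)) has_integral
      exp (w * complex_of_real (s + l)) / w - exp (w * complex_of_real s) / w) {s..s + l}"
  proof (rule fundamental_theorem_of_calculus)
    show "((\<lambda>t. exp (w * complex_of_real t) / w) has_vector_derivative exp (w * complex_of_real t))
        (at t within {s..s + l})" for t
      unfolding has_vector_derivative_def using w
      by (auto intro!: derivative_eq_intros has_derivative_compose[of "\<lambda>t. w * complex_of_real t" _ _ _ exp,
            OF _ DERIV_exp[unfolded has_field_derivative_def]] simp: scaleR_conv_of_real)
  qed (use assms in auto)
  moreover have "exp (w * complex_of_real (s + l)) = exp (w * complex_of_real s)"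
  proof -
    have "w * complex_of_real (s + l) = w * complex_of_real s + (2 * of_int k * of_real pi) * \<i>"
      using assms by (simp add: w_def field_simps)
    then show ?thesis using exp_integer_2pi[of "of_int k"] by (simp only: exp_add) simp
  qed
  ultimately have "integral {s..s + l} (\<lambda>t. exp (w * complex_of_real t)) = 0"
    by (simp add: integral_unique)
  then show ?thesis using False by (simp add: w_def mult.assoc)
qed

text \<open>
  Orthogonality of the exponentials \<open>exp(\<i> 2\<pi>m\<cdot>x/l)\<close> on any cube of side \<open>l\<close>, stated for their
  quotients.
\<close>

lemma integral_cube_character:
  fixes k :: "'n::finite \<Rightarrow> int" and a b :: "real ^ 'n"
  assumes "l > 0" and "\<And>i. b $ i = a $ i + l"
  shows "(\<integral>x. indicator (cbox a b) x *\<^sub>R exp (\<i> * complex_of_real (x \<bullet> (\<chi> i. 2 * pi * k i / l))) \<partial>lborel)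
    = (if k = (\<lambda>i. 0) then complex_of_real (l ^ CARD('n)) else 0)"
proof -
  have "exp (\<i> * complex_of_real (x \<bullet> (\<chi> i. 2 * pi * k i / l)))
      = (\<Prod>i\<in>UNIV. exp (\<i> * complex_of_real (2 * pi * k i / l * x $ i)))" for x :: "real ^ 'n"
    by (simp add: inner_vec_def sum_distrib_left mult_ac flip: exp_sum)
  then have "(\<integral>x. indicator (cbox a b) x *\<^sub>R exp (\<i> * complex_of_real (x \<bullet> (\<chi> i. 2 * pi * k i / l))) \<partial>lborel)
    = (\<Prod>i\<in>UNIV. integral {a $ i..b $ i} (\<lambda>t. exp (\<i> * complex_of_real (2 * pi * k i / l * t))))"
    by (simp only:) (intro integral_cbox_prod continuous_intros)
  also have "\<dots> = (\<Prod>i\<in>UNIV. if k i = 0 then complex_of_real l else 0)"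
    by (simp only: assms(2) integral_exp_period[OF assms(1)])
  also have "\<dots> = (if k = (\<lambda>i. 0) then complex_of_real (l ^ CARD('n)) else 0)"
    by (auto simp: fun_eq_iff)
  finally show ?thesis .
qed

lemma japanese_bounds: "1 \<le> japanese \<xi>" "japanese \<xi> \<le> 1 + norm \<xi>"
proof -
  show "1 \<le> japanese \<xi>" by (simp add: japanese_def)
  show "japanese \<xi> \<le> 1 + norm \<xi>"
    unfolding japanese_def by (rule real_le_lsqrt) (simp_all add: power2_eq_square algebra_simps)
qed

text \<open>
  Since \<open>\<langle>\<xi>\<rangle>\<^sup>2 \<ge> 1 + \<xi>\<^sub>i\<^sup>2\<close> for each coordinate, \<open>\<langle>\<xi>\<rangle>\<^sup>-\<^sup>2\<^sup>n\<close> is dominated by the product of the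
  \<open>1/(1 + \<xi>\<^sub>i\<^sup>2)\<close>.
\<close>

lemma integrable_japanese:
  "integrable lborel (\<lambda>\<xi> :: real ^ 'n. japanese \<xi> powr (2 * (- real CARD('n))))"
proof -
  have "integrable lborel (\<lambda>t::real. inverse (1 + t\<^sup>2))"
    using integrable_inverse_1_plus_square by (simp add: set_integrable_def)
  then have int: "integrable lborel (\<lambda>\<xi>::real^'n. \<Prod>i\<in>UNIV. inverse (1 + (\<xi> $ i)\<^sup>2))"
    by (intro lborel_integral_prod_vec(1))
  have le: "japanese \<xi> powr (2 * (- real CARD('n))) \<le> \<bar>\<Prod>i\<in>UNIV. inverse (1 + (\<xi> $ i)\<^sup>2)\<bar>" for \<xi> :: "real ^ 'n"
  proof -
    have "japanese \<xi> powr (2 * (- real CARD('n))) = inverse (japanese \<xi> powr real (2 * CARD('n)))"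
      by (simp add: powr_minus)
    also have "\<dots> = inverse (japanese \<xi> ^ (2 * CARD('n)))"
      using japanese_bounds(1)[of \<xi>] by (subst powr_realpow) auto
    also have "\<dots> = (\<Prod>i\<in>(UNIV::'n set). inverse (1 + (norm \<xi>)\<^sup>2))"
      by (simp add: japanese_def power_mult power_inverse)
    also have "\<dots> \<le> (\<Prod>i\<in>UNIV. inverse (1 + (\<xi> $ i)\<^sup>2))"
    proof (intro prod_mono conjI le_imp_inverse_le add_left_mono)
      fix i
      show "(\<xi> $ i)\<^sup>2 \<le> (norm \<xi>)\<^sup>2"
        using component_le_norm_cart[of \<xi> i] by (metis abs_ge_zero power2_abs power_mono)
      show "0 < 1 + (\<xi> $ i)\<^sup>2" by (simp add: add_pos_nonneg)
    qed auto
    also have "\<dots> \<le> \<bar>\<Prod>i\<in>UNIV. inverse (1 + (\<xi> $ i)\<^sup>2)\<bar>" by (rule abs_ge_self)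
    finally show ?thesis .
  qed
  show ?thesis
    by (rule Bochner_Integration.integrable_bound[OF int])
      (use le in \<open>auto simp: japanese_def\<close>)
qed

section \<open>Counting lattice points in phase space\<close>

definition cube :: "real \<Rightarrow> ('n \<Rightarrow> int) \<Rightarrow> (real ^ 'n) set" where
  "cube l a = cbox (\<chi> i. l * real_of_int (a i)) (\<chi> i. l * (real_of_int (a i) + 1))"

lemma mem_cube:
  "x \<in> cube l a \<longleftrightarrow> (\<forall>i. l * real_of_int (a i) \<le> x $ i \<and> x $ i \<le> l * (real_of_int (a i) + 1))"
  by (simp add: cube_def mem_box_cart)

lemma mem_cube_floor:
  fixes l :: real
  assumes "l > 0"
  shows "x \<in> cube l (\<lambda>i. \<lfloor>x $ i / l\<rfloor>)"
proof -
  have "l * \<lfloor>x $ i / l\<rfloor> \<le> l * (x $ i / l)" "l * (x $ i / l) \<le> l * (\<lfloor>x $ i / l\<rfloor> + 1)" for i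
    using assms by (intro mult_left_mono; linarith)+
  then show ?thesis using assms by (simp add: mem_cube)
qed

lemma dist_cube_le:
  fixes x y :: "real ^ 'n" and l :: real
  assumes "x \<in> cube l a" and "y \<in> cube l a"
  shows "dist x y \<le> CARD('n) * l"
proof -
  have "dist x y \<le> (\<Sum>i\<in>UNIV. \<bar>(x - y) $ i\<bar>)"
    unfolding dist_norm by (rule norm_le_l1_cart)
  also have "\<dots> \<le> (\<Sum>i\<in>(UNIV :: 'n set). l)"
  proof (rule sum_mono)
    fix i
    have "l * (a i + 1) = l * a i + l" by (simp add: algebra_simps)
    then show "\<bar>(x - y) $ i\<bar> \<le> l"
      using assms[unfolded mem_cube, THEN spec[of _ i]] by (simp add: abs_le_iff)
  qed
  finally show ?thesis by simp
qed

text \<open>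
  By inner regularity a compact \<open>C \<subseteq> U\<close> already has measure above \<open>v\<close>. Grid cells smaller than the
  distance of \<open>C\<close> to the complement of \<open>U\<close> stay inside \<open>U\<close> as soon as they meet \<open>C\<close>, and these
  cells cover \<open>C\<close>.
\<close>

lemma inner_grid_approximation:
  fixes U :: "((real ^ 'n) \<times> (real ^ 'n)) set"
  assumes "open U" and "bounded U" and "v < measure lborel U"
  obtains l :: real and Z :: "(('n \<Rightarrow> int) \<times> ('n \<Rightarrow> int)) set"
  where "l > 0" and "finite Z" and "\<And>a b. (a, b) \<in> Z \<Longrightarrow> cube l a \<times> cube l b \<subseteq> U"
    and "v < card Z * l ^ (2 * CARD('n))"
proof -
  have Um: "U \<in> lmeasurable" using assms by (simp add: bounded_set_imp_lmeasurable)
  obtain C where C: "closed C" "C \<subseteq> U" "U - C \<in> lmeasurable"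
      "emeasure lebesgue (U - C) < ennreal (measure lborel U - v)"
    using sets_lebesgue_inner_closed[of U "measure lborel U - v"] assms Um by auto
  have compC: "compact C"
    using C assms(2) bounded_subset compact_eq_bounded_closed by blast
  have "measure lebesgue (U - C) = measure lebesgue U - measure lebesgue C"
    using compC C Um by (intro measure_Diff) (auto simp: lmeasurable_compact fmeasurable_def)
  moreover have "measure lebesgue (U - C) < measure lborel U - v"
    using C(3,4) assms(3) by (simp add: emeasure_eq_measure2 ennreal_less_iff)
  ultimately have vC: "v < measure lborel C"
    using assms(1) C(1) by simp
  obtain d where d: "d > 0" "\<And>p q. p \<in> C \<Longrightarrow> q \<in> - U \<Longrightarrow> d \<le> dist p q"
    using separate_compact_closed[of C "- U"] compC C(2) assms(1) by (auto simp: closed_Compl) blast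
  (* A cube of side l has diameter at most n l, a product of two cubes at most 2 n l = d/2. *)
  define l where "l = d / (4 * CARD('n))"
  have l: "l > 0" using d by (simp add: l_def)
  define cell where "cell = (\<lambda>x :: real ^ 'n. \<lambda>i. \<lfloor>x $ i / l\<rfloor>)"
  define Z where "Z = (\<lambda>(x, \<xi>). (cell x, cell \<xi>)) ` C"
  have cell: "x \<in> cube l (cell x)" for x
    using mem_cube_floor[OF l] by (simp add: cell_def)
  obtain R where R: "\<And>p. p \<in> C \<Longrightarrow> norm p \<le> R"
    using compC compact_imp_bounded bounded_iff by metis
  define F where "F = PiE (UNIV :: 'n set) (\<lambda>_. {\<lfloor>- R / l\<rfloor>..\<lfloor>R / l\<rfloor>})"
  have "cell x \<in> F" if "norm x \<le> R" for x
  proof -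
    have "- R \<le> x $ i" "x $ i \<le> R" for i
      using component_le_norm_cart[of x i] that by linarith+
    then have "- R / l \<le> x $ i / l" "x $ i / l \<le> R / l" for i
      using l by (intro divide_right_mono; simp)+
    then show ?thesis
      by (auto simp: F_def cell_def intro!: floor_mono simp del: minus_divide_left)
  qed
  moreover have "norm x \<le> R \<and> norm \<xi> \<le> R" if "(x, \<xi>) \<in> C" for x \<xi>
    using R[OF that] norm_fst_le[of x \<xi>] norm_snd_le[of \<xi> x] by linarith
  ultimately have "Z \<subseteq> F \<times> F" by (auto simp: Z_def)
  then have finZ: "finite Z"
    by (rule finite_subset) (auto simp: F_def intro!: finite_cartesian_product finite_PiE)
  have sub: "cube l a \<times> cube l b \<subseteq> U" if ab: "(a, b) \<in> Z" for a b
  proof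
    fix q assume "q \<in> cube l a \<times> cube l b"
    then obtain y \<eta> where q: "q = (y, \<eta>)" "y \<in> cube l a" "\<eta> \<in> cube l b" by auto
    obtain x \<xi> where p: "(x, \<xi>) \<in> C" "a = cell x" "b = cell \<xi>"
      using ab by (auto simp: Z_def)
    have "dist (x, \<xi>) (y, \<eta>) \<le> dist x y + dist \<xi> \<eta>"
      unfolding dist_Pair_Pair by (rule sqrt_sum_squares_le_sum) auto
    also have "\<dots> \<le> CARD('n) * l + CARD('n) * l"
      using p q cell by (intro add_mono dist_cube_le) auto
    also have "\<dots> < d" using d by (simp add: l_def)
    finally show "q \<in> U" using d(2)[OF p(1), of q] q by fastforce
  qed
  have "measure lborel C \<le> measure lborel (\<Union>(a, b)\<in>Z. cube l a \<times> cube l b)"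
  proof (rule measure_mono_fmeasurable)
    show "C \<subseteq> (\<Union>(a, b)\<in>Z. cube l a \<times> cube l b)"
      using cell by (force simp: Z_def)
    show "(\<Union>(a, b)\<in>Z. cube l a \<times> cube l b) \<in> fmeasurable lborel"
      using finZ by (auto simp: cube_def cbox_Pair_eq[symmetric] intro!: fmeasurable.finite_UN fmeasurable_cbox)
  qed (use C(1) in auto)
  also have "\<dots> \<le> (\<Sum>(a, b)\<in>Z. measure lborel (cube l a \<times> cube l b))"
    using finZ measure_UNION_le[of Z "\<lambda>(a, b). cube l a \<times> cube l b" lborel]
    by (auto simp: cube_def cbox_Pair_eq[symmetric] case_prod_unfold)
  also have "\<dots> = (\<Sum>(a, b)\<in>Z. l ^ (2 * CARD('n)))"
  proof (intro sum.cong refl, clarify)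
    fix a b :: "'n \<Rightarrow> int"
    have content: "measure lborel (cube l a) = l ^ CARD('n)" for a :: "'n \<Rightarrow> int"
    proof -
      have "(\<chi> i. l * a i) \<in> cube l a" using l by (simp add: mem_cube)
      then have "cube l a \<noteq> {}" by (metis empty_iff)
      then have ne: "cbox (\<chi> i. l * real_of_int (a i)) (\<chi> i. l * (real_of_int (a i) + 1)) \<noteq> {}"
        by (simp only: cube_def not_False_eq_True)
      have "measure lborel (cube l a) = (\<Prod>i\<in>(UNIV::'n set). l * (real_of_int (a i) + 1) - l * real_of_int (a i))"
        unfolding cube_def by (simp only: content_cbox_cart[OF ne] vec_lambda_beta)
      also have "\<dots> = l ^ CARD('n)" by (simp add: algebra_simps)
      finally show ?thesis .
    qed
    have "measure lborel (cube l a \<times> cube l b) = measure lborel (cube l a) * measure lborel (cube l b)"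
      by (simp add: cube_def content_Pair flip: cbox_Pair_eq)
    then show "measure lborel (cube l a \<times> cube l b) = l ^ (2 * CARD('n))"
      by (simp add: content power_add mult_2)
  qed
  also have "\<dots> = card Z * l ^ (2 * CARD('n))" by simp
  finally show thesis using that[OF l finZ sub] vC by simp
qed

text \<open>The fibre consists of the integers in the half-open interval from \<open>c/s\<close> to \<open>(c+1)/s\<close>.\<close>

lemma card_floor_fibre:
  fixes s :: real and c :: int
  assumes "s > 0"
  defines "F \<equiv> {t::int. \<lfloor>s * t\<rfloor> = c}"
  shows "finite F" and "1 / s - 1 \<le> card F" and "card F \<le> 1 / s + 1"
proof -
  have eq: "F = {\<lceil>c / s\<rceil>..<\<lceil>(c + 1) / s\<rceil>}"
    using assms(1) by (auto simp: F_def floor_eq_iff ceiling_le_iff less_ceiling_iff field_simps)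
  have le: "\<lceil>c / s\<rceil> \<le> \<lceil>(c + 1) / s\<rceil>"
    using assms(1) by (intro ceiling_mono) (simp add: divide_right_mono)
  have "real (card F) = real_of_int (\<lceil>(c + 1) / s\<rceil> - \<lceil>c / s\<rceil>)"
    using le by (simp add: eq)
  moreover have "(c + 1) / s = c / s + 1 / s" by (simp add: add_divide_distrib)
  ultimately show "1 / s - 1 \<le> card F" "card F \<le> 1 / s + 1"
    by linarith+
  show "finite F" by (simp add: eq)
qed

text \<open>
  Pairs of a space cell \<open>a\<close> and a lattice point \<open>m\<close> such that \<open>s m\<close> lies in the half-open unit cube
  at \<open>b\<close> for a pair \<open>(a, b) \<in> Z\<close>. Half-open cubes are disjoint, so no lattice point is counted
  twice for the same \<open>a\<close>.
\<close>

definition lattice_cells ::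
    "real \<Rightarrow> (('n::finite \<Rightarrow> int) \<times> ('n \<Rightarrow> int)) set \<Rightarrow> (('n \<Rightarrow> int) \<times> ('n \<Rightarrow> int)) set" where
  "lattice_cells s Z = {(a, m). (a, \<lambda>i. \<lfloor>s * real_of_int (m i)\<rfloor>) \<in> Z}"

lemma card_lattice_cells:
  fixes Z :: "(('n::finite \<Rightarrow> int) \<times> ('n \<Rightarrow> int)) set" and s :: real
  assumes "0 < s" and "s \<le> 1" and "finite Z"
  shows "finite (lattice_cells s Z)"
    and "card Z * (1 / s - 1) ^ CARD('n) \<le> card (lattice_cells s Z)"
    and "card (lattice_cells s Z) \<le> card Z * (1 / s + 1) ^ CARD('n)"
proof -
  define P where "P = (\<lambda>b :: 'n \<Rightarrow> int. PiE UNIV (\<lambda>i. {t::int. \<lfloor>s * t\<rfloor> = b i}))"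
  have P: "finite (P b)" "card (P b) = (\<Prod>i\<in>UNIV. card {t::int. \<lfloor>s * t\<rfloor> = b i})" for b
    using card_floor_fibre(1)[OF assms(1)] by (auto simp: P_def card_PiE intro!: finite_PiE)
  define S where "S = (SIGMA z:Z. P (snd z))"
  have mem_S: "((a, b), m) \<in> S \<longleftrightarrow> (a, b) \<in> Z \<and> (\<lambda>i. \<lfloor>s * m i\<rfloor>) = b" for a b m
    by (auto simp: S_def P_def PiE_iff fun_eq_iff)
  have bij: "bij_betw (\<lambda>(z, m). (fst z, m)) S (lattice_cells s Z)"
  proof (rule bij_betw_imageI)
    show "inj_on (\<lambda>(z, m). (fst z, m)) S"
      by (rule inj_onI) (auto simp: mem_S)
    show "(\<lambda>(z, m). (fst z, m)) ` S = lattice_cells s Z"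
    proof (intro equalityI subsetI)
      fix p assume "p \<in> lattice_cells s Z"
      then have "((fst p, \<lambda>i. \<lfloor>s * snd p i\<rfloor>), snd p) \<in> S"
        by (auto simp: lattice_cells_def mem_S)
      then show "p \<in> (\<lambda>(z, m). (fst z, m)) ` S"
        by (rule rev_image_eqI) simp
    qed (auto simp: lattice_cells_def mem_S)
  qed
  have "finite S" using P assms(3) by (simp add: S_def)
  then show "finite (lattice_cells s Z)" using bij bij_betw_finite by blast
  have card: "real (card (lattice_cells s Z)) = (\<Sum>z\<in>Z. \<Prod>i\<in>UNIV. real (card {t::int. \<lfloor>s * t\<rfloor> = snd z i}))"
    using P assms(3) by (simp add: bij_betw_same_card[OF bij, symmetric] S_def)
  have "1 \<le> 1 / s" using assms by simp
  have "(\<Sum>z\<in>Z. \<Prod>i\<in>(UNIV::'n set). (1 / s - 1)) \<le> card (lattice_cells s Z)"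
    unfolding card using card_floor_fibre(2)[OF assms(1)] \<open>1 \<le> 1 / s\<close> by (intro sum_mono prod_mono) auto
  then show "card Z * (1 / s - 1) ^ CARD('n) \<le> card (lattice_cells s Z)" by simp
  have "card (lattice_cells s Z) \<le> (\<Sum>z\<in>Z. \<Prod>i\<in>(UNIV::'n set). (1 / s + 1))"
    unfolding card using card_floor_fibre(3)[OF assms(1)] by (intro sum_mono prod_mono) auto
  then show "card (lattice_cells s Z) \<le> card Z * (1 / s + 1) ^ CARD('n)" by simp
qed

section \<open>Wave packets\<close>

definition freq :: "real \<Rightarrow> ('n \<Rightarrow> int) \<Rightarrow> real ^ 'n" where
  "freq l m = (\<chi> i. 2 * pi * real_of_int (m i) / l)"

definition character :: "real \<Rightarrow> ('n \<Rightarrow> int) \<Rightarrow> real ^ 'n \<Rightarrow> complex" where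
  "character l m x = exp (\<i> * complex_of_real (x \<bullet> freq l m))"

lemma norm_character [simp]: "cmod (character l m x) = 1"
  by (simp add: character_def norm_exp_eq_Re)

lemma smooth_character: "smooth (character l m)"
  unfolding character_def[abs_def] by (rule smooth_exp_inner)

lemma fourier_character:
  "fourier (\<lambda>x. g x * character l m x) z = fourier g (z - freq l m)"
  by (auto simp: fourier_def character_def inner_diff_right ring_distribs exp_diff exp_minus exp_add field_simps
      intro!: Bochner_Integration.integral_cong)

text \<open>
  The coefficient of index \<open>m\<^sub>0\<close> is the integral over the cube of the trigonometric sum divided by
  the exponential of index \<open>m\<^sub>0\<close>, which has modulus \<open>1\<close>.
\<close>

lemma trig_coefficient_bound:
  fixes c :: "('n::finite \<Rightarrow> int) \<Rightarrow> complex" and a b :: "real ^ 'n"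
  assumes "l > 0" and b: "\<And>i. b $ i = a $ i + l" and "finite M" and "m\<^sub>0 \<in> M"
  shows "cmod (c m\<^sub>0) * l ^ CARD('n)
    \<le> (\<integral>x. indicator (cbox a b) x * cmod (\<Sum>m\<in>M. c m * character l m x) \<partial>lborel)"
proof -
  define k where "k = (\<lambda>m::'n \<Rightarrow> int. \<lambda>i. m i - m\<^sub>0 i)"
  have char_k: "character l (k m) x = character l m x / character l m\<^sub>0 x" for m x
  proof -
    have "freq l (k m) = freq l m - freq l m\<^sub>0"
      by (simp add: k_def freq_def vec_eq_iff right_diff_distrib diff_divide_distrib)
    then show ?thesis
      by (simp add: character_def inner_diff_right ring_distribs exp_diff)
  qed
  have char_int: "(\<integral>x. indicator (cbox a b) x *\<^sub>R character l m x \<partial>lborel)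
      = (if m = (\<lambda>i. 0) then complex_of_real (l ^ CARD('n)) else 0)" for m :: "'n \<Rightarrow> int"
    unfolding character_def freq_def by (rule integral_cube_character[OF assms(1) b])
  have int: "integrable lborel (\<lambda>x. indicator (cbox a b) x *\<^sub>R g x)"
    if "continuous_on UNIV g" for g :: "real ^ 'n \<Rightarrow> complex"
    using that by (intro borel_integrable_compact) (auto intro: continuous_on_subset)
  have cont: "continuous_on UNIV (character l m)" for m :: "'n \<Rightarrow> int"
    by (intro smooth_imp_continuous smooth_character)
  have "complex_of_real (l ^ CARD('n)) * c m\<^sub>0 = (\<Sum>m\<in>M. c m * (if m = m\<^sub>0 then complex_of_real (l ^ CARD('n)) else 0))"
    using assms(3,4) by (simp add: if_distrib cong: if_cong)
  also have "\<dots> = (\<Sum>m\<in>M. c m * (\<integral>x. indicator (cbox a b) x *\<^sub>R character l (k m) x \<partial>lborel))"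
    by (intro sum.cong refl) (auto simp: char_int k_def fun_eq_iff)
  also have "\<dots> = (\<integral>x. (\<Sum>m\<in>M. c m * (indicator (cbox a b) x *\<^sub>R character l (k m) x)) \<partial>lborel)"
    by (simp add: Bochner_Integration.integral_sum integrable_mult_right[OF int[OF cont]] del: mult_scaleR_right)
  also have "cmod \<dots> \<le> (\<integral>x. cmod (\<Sum>m\<in>M. c m * (indicator (cbox a b) x *\<^sub>R character l (k m) x)) \<partial>lborel)"
    by (rule integral_norm_bound)
  also have "\<dots> = (\<integral>x. indicator (cbox a b) x * cmod (\<Sum>m\<in>M. c m * character l m x) \<partial>lborel)"
  proof (intro Bochner_Integration.integral_cong refl)
    fix x :: "real ^ 'n"
    have "(\<Sum>m\<in>M. c m * (indicator (cbox a b) x *\<^sub>R character l (k m) x))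
        = indicator (cbox a b) x *\<^sub>R ((\<Sum>m\<in>M. c m * character l m x) / character l m\<^sub>0 x)"
      by (simp add: char_k sum_divide_distrib scaleR_sum_right)
    then show "cmod (\<Sum>m\<in>M. c m * (indicator (cbox a b) x *\<^sub>R character l (k m) x))
        = indicator (cbox a b) x * cmod (\<Sum>m\<in>M. c m * character l m x)"
      by (simp add: norm_divide)
  qed
  finally show ?thesis using assms(1) by (simp add: norm_mult mult.commute norm_power)
qed

definition cell_bump :: "real \<Rightarrow> ('n::finite \<Rightarrow> int) \<Rightarrow> real ^ 'n \<Rightarrow> complex" where
  "cell_bump l a = bump (\<chi> i. l * real_of_int (a i)) (\<chi> i. l * (real_of_int (a i) + 1))"

lemma cell_bump_eq_0_iff:
  "cell_bump l a x = 0 \<longleftrightarrow> \<not> (\<forall>i. l * real_of_int (a i) < x $ i \<and> x $ i < l * (real_of_int (a i) + 1))"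
  by (simp add: cell_bump_def bump_eq_0_iff mem_box_cart)

lemma cell_bump_nonzeroD: "cell_bump l a x \<noteq> 0 \<Longrightarrow> x \<in> cube l a"
  by (auto simp: cell_bump_eq_0_iff mem_cube less_imp_le)

lemma cell_bump_disjoint:
  assumes "l > 0" and "cell_bump l a x \<noteq> 0" and "cell_bump l b x \<noteq> 0"
  shows "a = b"
proof
  fix i
  have "l * real_of_int (a i) < l * (real_of_int (b i) + 1)" "l * real_of_int (b i) < l * (real_of_int (a i) + 1)"
    using assms(2,3) unfolding cell_bump_eq_0_iff by (meson less_trans)+
  then have "real_of_int (a i) < real_of_int (b i) + 1" "real_of_int (b i) < real_of_int (a i) + 1"
    using assms(1) by simp_all
  then show "a i = b i" by linarith
qed

lemma smooth_cell_bump: "smooth (cell_bump l a)"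
  unfolding cell_bump_def by (rule smooth_bump)

lemma test_function_cell_bump: "test_function (cell_bump l a)"
  unfolding test_function_iff
  using compact_suppI(1)[of "cube l a" "cell_bump l a"] cell_bump_nonzeroD[of l a]
  by (auto simp: smooth_cell_bump cube_def compact_cbox)

text \<open>
  On the concentric subcube of side \<open>l'\<close> in the cell \<open>a\<close> only the packets of that cell are present,
  and the bump is at least some \<open>\<kappa> > 0\<close> there. So the trigonometric sum of the cell is
  bounded by \<open>|f|/\<kappa>\<close>, and \<open>|f| \<le> 1 + |f|\<^sup>2\<close> gives the \<open>L\<^sup>2\<close> norm. The constant depends on
  neither the number of packets nor their frequencies.
\<close>

lemma wave_packet_coefficient_bound:
  fixes c :: "(('n::finite \<Rightarrow> int) \<times> ('n \<Rightarrow> int)) \<Rightarrow> complex"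
  assumes "0 < l'" and "l' < l"
  obtains L where "L > 0" and "\<And>J c a m f. finite J \<Longrightarrow> (a, m) \<in> J \<Longrightarrow>
      f = (\<lambda>x. \<Sum>(a, m)\<in>J. c (a, m) * (cell_bump l a x * character l' m x)) \<Longrightarrow>
      integrable lborel (\<lambda>x. (cmod (f x))\<^sup>2) \<Longrightarrow>
      cmod (c (a, m :: 'n \<Rightarrow> int)) \<le> L * (1 + (\<integral>x. (cmod (f x))\<^sup>2 \<partial>lborel))"
proof -
  define \<rho> where "\<rho> = (l - l') / 2"
  have \<rho>: "\<rho> > 0" using assms by (simp add: \<rho>_def)
  define \<kappa> where "\<kappa> = exp (- (1 / \<rho>)) ^ (2 * CARD('n))"
  have \<kappa>: "\<kappa> > 0" by (simp add: \<kappa>_def)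
  define V where "V = l' ^ CARD('n)"
  have V: "V > 0" using assms by (simp add: V_def)
  show thesis
  proof
    show "(V + 1) / (\<kappa> * V) > 0" using \<kappa> V by simp
  next
    fix J :: "(('n \<Rightarrow> int) \<times> ('n \<Rightarrow> int)) set" and c a and m\<^sub>0 :: "'n \<Rightarrow> int" and f
    assume J: "finite J" "(a, m\<^sub>0) \<in> J"
      and f: "f = (\<lambda>x. \<Sum>(a, m)\<in>J. c (a, m) * (cell_bump l a x * character l' m x))"
      and int: "integrable lborel (\<lambda>x. (cmod (f x))\<^sup>2)"
    define M where "M = {m. (a, m) \<in> J}"
    define p where "p = (\<lambda>x. \<Sum>m\<in>M. c (a, m) * character l' m x)"
    define Q where "Q = cbox (\<chi> i. l * real_of_int (a i) + \<rho>) (\<chi> i. l * real_of_int (a i) + \<rho> + l')"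
    have M: "finite M" "m\<^sub>0 \<in> M"
      using J finite_subset[of M "snd ` J"] by (force simp: M_def)+
    have bump: "\<kappa> \<le> cmod (cell_bump l a x)" if "x \<in> Q" for x
      unfolding \<kappa>_def cell_bump_def using \<rho> that
      by (intro bump_lower_bound) (auto simp: Q_def mem_box_cart \<rho>_def field_simps)
    have pf: "\<kappa> * cmod (p x) \<le> 1 + (cmod (f x))\<^sup>2" if "x \<in> Q" for x
    proof -
      have nz: "cell_bump l a x \<noteq> 0" using bump[OF that] \<kappa> by auto
      have disj: "cell_bump l b x = 0" if "b \<noteq> a" for b
        using cell_bump_disjoint[of l a x b] nz that assms by auto
      have "f x = (\<Sum>(b, m)\<in>J. if b = a then cell_bump l a x * (c (a, m) * character l' m x) else 0)"
        unfolding f using disj by (intro sum.cong) auto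
      also have "\<dots> = (\<Sum>(b, m)\<in>Pair a ` M. cell_bump l a x * (c (a, m) * character l' m x))"
        using J(1) by (intro sum.mono_neutral_cong_right) (auto simp: M_def)
      also have "\<dots> = cell_bump l a x * p x"
        by (subst sum.reindex) (auto simp: inj_on_def p_def sum_distrib_left)
      finally have "cmod (f x) = cmod (cell_bump l a x) * cmod (p x)" by (simp add: norm_mult)
      then have "\<kappa> * cmod (p x) \<le> cmod (f x)" using bump[OF that] by (simp add: mult_right_mono)
      also have "\<dots> \<le> 1 + (cmod (f x))\<^sup>2"
        using zero_le_power2[of "cmod (f x) - 1"] by (simp add: power2_diff) (smt (verit) norm_ge_zero)
      finally show ?thesis .
    qed
    have Q_meas: "integrable lborel (indicator Q :: _ \<Rightarrow> real)" "measure lborel Q = V"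
    proof -
      show "integrable lborel (indicator Q :: _ \<Rightarrow> real)"
        using emeasure_lborel_cbox_finite by (simp add: Q_def integrable_indicator_iff infinity_ennreal_def)
      have "(\<chi> i. l * real_of_int (a i) + \<rho>) \<in> Q" using assms by (simp add: Q_def mem_box_cart)
      then have ne: "Q \<noteq> {}" by (metis empty_iff)
      show "measure lborel Q = V"
        unfolding Q_def V_def by (simp only: content_cbox_cart[OF ne[unfolded Q_def]] vec_lambda_beta) simp
    qed
    have "cmod (c (a, m\<^sub>0)) * V \<le> (\<integral>x. indicator Q x * cmod (p x) \<partial>lborel)"
      using trig_coefficient_bound[of l' "\<chi> i. l * real_of_int (a i) + \<rho> + l'" "\<chi> i. l * real_of_int (a i) + \<rho>" M m\<^sub>0 "\<lambda>m. c (a, m)"]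
        assms(1) M by (simp add: V_def Q_def p_def)
    also have "\<dots> \<le> (\<integral>x. (indicator Q x + (cmod (f x))\<^sup>2) / \<kappa> \<partial>lborel)"
    proof (rule integral_mono')
      show "integrable lborel (\<lambda>x. (indicator Q x + (cmod (f x))\<^sup>2) / \<kappa>)"
        using Q_meas(1) int by simp
      show "indicator Q x * cmod (p x) \<le> (indicator Q x + (cmod (f x))\<^sup>2) / \<kappa>" for x
        using pf[of x] \<kappa> by (auto simp: indicator_def field_simps)
    qed (use \<kappa> in \<open>auto simp: indicator_def\<close>)
    also have "\<dots> = (V + (\<integral>x. (cmod (f x))\<^sup>2 \<partial>lborel)) / \<kappa>"
      using Q_meas int by simp
    also have "\<dots> \<le> (V + 1) * (1 + (\<integral>x. (cmod (f x))\<^sup>2 \<partial>lborel)) / \<kappa>"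
      using V \<kappa> by (intro divide_right_mono) (auto simp: algebra_simps)
    finally show "cmod (c (a, m\<^sub>0)) \<le> (V + 1) / (\<kappa> * V) * (1 + (\<integral>x. (cmod (f x))\<^sup>2 \<partial>lborel))"
      using V \<kappa> by (simp add: field_simps)
  qed
qed

definition wave_packets ::
    "real \<Rightarrow> real \<Rightarrow> (('n::finite \<Rightarrow> int) \<times> ('n \<Rightarrow> int)) set \<Rightarrow> (('n \<Rightarrow> int) \<times> ('n \<Rightarrow> int) \<Rightarrow> complex)
      \<Rightarrow> real ^ 'n \<Rightarrow> complex" where
  "wave_packets l l' J c x = (\<Sum>(a, m)\<in>J. c (a, m) * (cell_bump l a x * character l' m x))"

lemma wave_packets_nonzeroD:
  assumes "wave_packets l l' J c x \<noteq> 0"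
  obtains a m where "(a, m) \<in> J" "x \<in> cube l a"
proof -
  obtain p where "p \<in> J" "(case p of (a, m) \<Rightarrow> c (a, m) * (cell_bump l a x * character l' m x)) \<noteq> 0"
    using assms unfolding wave_packets_def by (meson sum.neutral)
  then show thesis using that[of "fst p" "snd p"] cell_bump_nonzeroD by (auto simp: case_prod_unfold)
qed

lemma smooth_wave_packets: "smooth (wave_packets l l' J c)"
  unfolding wave_packets_def[abs_def] case_prod_unfold
  by (intro smooth_sum smooth_mult smooth_const smooth_cell_bump smooth_character)

lemma test_function_wave_packets:
  assumes "finite J"
  shows "test_function (wave_packets l l' J c)"
proof -
  have "compact (\<Union>(a, m)\<in>J. cube l a)"
    using assms by (auto intro!: compact_UN simp: cube_def compact_cbox)
  then have "compact (supp (wave_packets l l' J c))"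
    by (rule compact_suppI) (use wave_packets_nonzeroD in fastforce)
  then show ?thesis by (simp add: test_function_iff smooth_wave_packets)
qed

lemma integrable_norm_square:
  fixes f :: "'a::euclidean_space \<Rightarrow> complex"
  assumes "test_function f"
  shows "integrable lborel (\<lambda>x. (cmod (f x))\<^sup>2)"
proof -
  have "continuous_on UNIV (\<lambda>x. (cmod (f x))\<^sup>2)"
    using assms by (intro continuous_intros smooth_imp_continuous) (simp add: test_function_iff)
  then show ?thesis
    by (rule integrable_compact_supp[of _ "supp f"]) (use assms in \<open>auto simp: test_function_iff not_in_supp\<close>)
qed

text \<open>
  Multiplication by an exponential shifts the Fourier transform, so each packet contributes the
  transform of \<open>\<psi>\<close> times a bump at distance at least \<open>r\<close> from the origin. If the
  product of \<open>\<psi>\<close> and the bump is identically zero, the packet contributes nothing; so the distance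
  is only required for cells that contain a point where \<open>\<psi>\<close> is nonzero.
\<close>

lemma norm_fourier_wave_packets_le:
  fixes c :: "('n::finite \<Rightarrow> int) \<times> ('n \<Rightarrow> int) \<Rightarrow> complex"
  assumes "smooth \<psi>" and "finite J" and "r > 0" and "B \<ge> 0"
    and c: "\<And>p. p \<in> J \<Longrightarrow> cmod (c p) \<le> B"
    and G: "\<And>a z. a \<in> fst ` J \<Longrightarrow> norm z ^ k * cmod (fourier (\<lambda>x. \<psi> x * cell_bump l a x) z) \<le> G"
    and far: "\<And>a m y. (a, m) \<in> J \<Longrightarrow> y \<in> cube l a \<Longrightarrow> \<psi> y \<noteq> 0 \<Longrightarrow> r \<le> norm (z - freq l' m)"
  shows "cmod (fourier (\<lambda>x. \<psi> x * wave_packets l l' J c x) z) \<le> card J * (B * (G / r ^ k))"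
proof -
  define g where "g = (\<lambda>a x. \<psi> x * cell_bump l a x)"
  have test: "test_function (\<lambda>x. g a x)" for a
    unfolding g_def using assms(1) test_function_cell_bump by (rule test_function_smooth_mult)
  have int: "integrable lborel (\<lambda>x. exp (- (\<i> * complex_of_real (x \<bullet> z))) * (character l' m x * g a x))" for a m
    by (intro test_function_integrable test_function_smooth_mult smooth_exp_minus_inner smooth_character test)
  have "fourier (\<lambda>x. \<psi> x * wave_packets l l' J c x) z
      = (\<integral>x. (\<Sum>(a, m)\<in>J. c (a, m) * (exp (- (\<i> * complex_of_real (x \<bullet> z))) * (character l' m x * g a x))) \<partial>lborel)"
    unfolding fourier_def wave_packets_def g_def
    by (intro Bochner_Integration.integral_cong refl) (auto simp: sum_distrib_left mult_ac intro!: sum.cong)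
  also have "\<dots> = (\<Sum>(a, m)\<in>J. c (a, m) * fourier (\<lambda>x. g a x * character l' m x) z)"
    using int by (subst Bochner_Integration.integral_sum) (auto simp: fourier_def mult_ac case_prod_unfold)
  also have "\<dots> = (\<Sum>(a, m)\<in>J. c (a, m) * fourier (g a) (z - freq l' m))"
    by (simp add: fourier_character)
  also have "cmod \<dots> \<le> (\<Sum>p\<in>J. B * (G / r ^ k))"
  proof (rule sum_norm_le)
    fix p assume p: "p \<in> J"
    obtain a m where am: "p = (a, m)" by (cases p)
    have "cmod (fourier (g a) (z - freq l' m)) \<le> G / r ^ k"
    proof (cases "\<exists>y. g a y \<noteq> 0")
      case True
      then obtain y where "\<psi> y \<noteq> 0" "y \<in> cube l a" using cell_bump_nonzeroD by (auto simp: g_def)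
      then have "r \<le> norm (z - freq l' m)" using far p am by blast
      then have "r ^ k * cmod (fourier (g a) (z - freq l' m)) \<le> norm (z - freq l' m) ^ k * cmod (fourier (g a) (z - freq l' m))"
        using assms(3) by (intro mult_right_mono power_mono) auto
      also have "\<dots> \<le> G" using G[of a "z - freq l' m"] p am by (force simp: g_def)
      finally show ?thesis using assms(3) by (simp add: field_simps)
    next
      case False
      have "a \<in> fst ` J" using p am by force
      then have "0 \<le> G" by (rule order_trans[OF _ G[of a 0], rotated]) simp
      with False show ?thesis using assms(3) by (simp add: fourier_def)
    qed
    then have "cmod (c (a, m)) * cmod (fourier (g a) (z - freq l' m)) \<le> B * (G / r ^ k)"
      using c[OF p] assms(4) unfolding am by (intro mult_mono) auto
    then show "cmod (case p of (a, m) \<Rightarrow> c (a, m) * fourier (g a) (z - freq l' m)) \<le> B * (G / r ^ k)"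
      by (simp only: am case_prod_conv norm_mult)
  qed
  also have "\<dots> = card J * (B * (G / r ^ k))" by simp
  finally show ?thesis .
qed

lemma L2_norm_square: "(L2_norm f)\<^sup>2 = (\<integral>x. (cmod (f x))\<^sup>2 \<partial>lborel)"
  by (simp add: L2_norm_def)

text \<open>
  Rescaling by \<open>s = 2\<pi>h/(l'l)\<close> turns the unit cube that contains \<open>s m\<close> into the frequency cube of
  side \<open>l\<close> that contains the semiclassical frequency \<open>2\<pi>hm/l'\<close>.
\<close>

lemma lattice_cells_freq_mem_cube:
  fixes m :: "'n::finite \<Rightarrow> int"
  assumes "(a, m) \<in> lattice_cells (2 * pi * h / (l' * l)) Z" and "l > 0" and "l' > 0"
  obtains b where "(a, b) \<in> Z" and "h *\<^sub>R freq l' m \<in> cube l b"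
proof
  let ?b = "\<lambda>i. \<lfloor>2 * pi * h / (l' * l) * m i\<rfloor>"
  show "(a, ?b) \<in> Z" using assms(1) by (simp add: lattice_cells_def)
  have "(h *\<^sub>R freq l' m) $ i / l = 2 * pi * h / (l' * l) * m i" for i
    by (simp add: freq_def)
  then show "h *\<^sub>R freq l' m \<in> cube l ?b"
    using mem_cube_floor[OF assms(2), of "h *\<^sub>R freq l' m"] by simp
qed

section \<open>Microlocalized functions vanishing at given points\<close>

text \<open>
  Gaussian elimination: a nonzero coefficient of the new equation allows its unknown to be
  eliminated from all the others.
\<close>

lemma homogeneous_system_nontrivial_solution:
  fixes a :: "'s \<Rightarrow> 'i \<Rightarrow> 'k::field"
  assumes "finite S" and "finite I" and "card S < card I"
  shows "\<exists>c. (\<exists>i\<in>I. c i \<noteq> 0) \<and> (\<forall>s\<in>S. (\<Sum>i\<in>I. c i * a s i) = 0)"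
  using assms
proof (induction S arbitrary: I a rule: finite_induct)
  case empty
  then obtain i where "i \<in> I" by fastforce
  then show ?case by (intro exI[of _ "\<lambda>_. 1"]) auto
next
  case (insert s S)
  show ?case
  proof (cases "\<forall>i\<in>I. a s i = 0")
    case True
    obtain c where "\<exists>i\<in>I. c i \<noteq> 0" "\<forall>s\<in>S. (\<Sum>i\<in>I. c i * a s i) = 0"
      using insert.IH[of I a] insert.prems insert.hyps by auto
    with True show ?thesis by (intro exI[of _ c]) auto
  next
    case False
    then obtain p where p: "p \<in> I" "a s p \<noteq> 0" by blast
    define I' where "I' = I - {p}"
    have I': "finite I'" "I = insert p I'" "p \<notin> I'" using p insert.prems by (auto simp: I'_def)
    then have "card S < card I'" using insert.prems insert.hyps by simp
    then obtain c where c: "\<exists>i\<in>I'. c i \<noteq> 0"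
      "\<And>t. t \<in> S \<Longrightarrow> (\<Sum>i\<in>I'. c i * (a t i - a t p * a s i / a s p)) = 0"
      using insert.IH[of I' "\<lambda>t i. a t i - a t p * a s i / a s p"] I'(1) by blast
    define q where "q = - (\<Sum>i\<in>I'. c i * a s i) / a s p"
    define c' where "c' = c(p := q)"
    have sum: "(\<Sum>i\<in>I. c' i * a t i) = q * a t p + (\<Sum>i\<in>I'. c i * a t i)" for t
    proof -
      have "(\<Sum>i\<in>I. c' i * a t i) = c' p * a t p + (\<Sum>i\<in>I'. c' i * a t i)"
        using I' by simp
      also have "(\<Sum>i\<in>I'. c' i * a t i) = (\<Sum>i\<in>I'. c i * a t i)"
        using I'(3) by (intro sum.cong) (auto simp: c'_def)
      finally show ?thesis by (simp add: c'_def)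
    qed
    have "(\<Sum>i\<in>I. c' i * a t i) = 0" if "t \<in> insert s S" for t
    proof (cases "t = s")
      case True
      then show ?thesis using p by (simp add: sum q_def)
    next
      case False
      have "q * a t p = - (\<Sum>i\<in>I'. c i * (a t p * a s i / a s p))"
        by (simp add: q_def sum_distrib_left sum_divide_distrib mult_ac)
      then show ?thesis
        using c(2)[of t] False that by (simp add: sum right_diff_distrib sum_subtractf)
    qed
    moreover have "\<exists>i\<in>I. c' i \<noteq> 0" using c(1) I' by (auto simp: c'_def)
    ultimately show ?thesis by blast
  qed
qed

text \<open>
  A quantitative, \<open>h\<close>-by-\<open>h\<close> substitute for having the wave front set in \<open>U\<close>: the transform of
  \<open>\<psi> f\<close> decays rapidly in the distance \<open>d\<close> of \<open>\<xi>\<close> from the part of \<open>U\<close> over the points where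
  \<open>\<psi>\<close> does not vanish. With \<open>\<psi> = 1\<close> the same bound expresses band limitation. The power
  \<open>k + n\<close> of \<open>d\<close> is what remains of \<open>(h/d)\<^sup>k\<^sup>+\<^sup>n\<close> when \<open>h\<^sup>n\<close> compensates the number of packets.
\<close>

definition microlocalized ::
    "((real ^ 'n \<Rightarrow> complex) \<Rightarrow> nat \<Rightarrow> real) \<Rightarrow> ((real ^ 'n) \<times> (real ^ 'n)) set \<Rightarrow> real \<Rightarrow> (real ^ 'n \<Rightarrow> complex) \<Rightarrow> bool"
  where
  "microlocalized A U h f \<longleftrightarrow>
     test_function f \<and> supp f \<subseteq> closure (fst ` U) \<and>
     (\<forall>\<psi> k \<xi> d. smooth \<psi> \<longrightarrow> 0 < d \<longrightarrow> (\<forall>(y, \<eta>)\<in>U. \<psi> y \<noteq> 0 \<longrightarrow> d \<le> norm (\<xi> - \<eta>)) \<longrightarrow>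
       cmod (fourier_h h (\<lambda>x. \<psi> x * f x) \<xi>) \<le> A \<psi> k * h ^ k / d ^ (k + CARD('n)))"

text \<open>
  The wave packets over a grid approximation of \<open>U\<close> number more than \<open>v (2\<pi>h)\<^sup>-\<^sup>n\<close>, so vanishing on
  \<open>S\<close> is an underdetermined linear system for their coefficients. The constants \<open>A\<close> depend on
  neither \<open>h\<close> nor the points.
\<close>

lemma microlocalized_functions_vanishing_on:
  fixes U :: "((real ^ 'n) \<times> (real ^ 'n)) set"
  assumes "open U" and "bounded U" and "v < measure lborel U"
  obtains A :: "(real ^ 'n \<Rightarrow> complex) \<Rightarrow> nat \<Rightarrow> real" and h1 :: real
  where "h1 > 0"
    and "\<And>h S. 0 < h \<Longrightarrow> h < h1 \<Longrightarrow> finite S \<Longrightarrow> card S \<le> v / (2 * pi * h) ^ CARD('n) \<Longrightarrow>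
      \<exists>f. microlocalized A U h f \<and> L2_norm f = 1 \<and> (\<forall>x\<in>S. f x = 0)"
proof -
  define n where "n = CARD('n)"
  obtain l :: real and Z where l: "l > 0" and Z: "finite Z" "\<And>a b. (a, b) \<in> Z \<Longrightarrow> cube l a \<times> cube l b \<subseteq> U"
    and vZ: "v < card Z * l ^ (2 * n)"
    using inner_grid_approximation[OF assms] unfolding n_def by metis
  (* The packets are counted with density (l' l)^n instead of l^(2 n), and rounding to lattice points
     costs another factor, no smaller than theta^n; theta is so close to 1 that both losses are affordable. *)
  have "((\<lambda>\<theta>. card Z * (\<theta> * l) ^ (2 * n)) \<longlongrightarrow> card Z * (1 * l) ^ (2 * n)) (at_left 1)"
    by (intro tendsto_intros)
  then have "\<forall>\<^sub>F \<theta> in at_left 1. v < card Z * (\<theta> * l) ^ (2 * n)"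
    using vZ by (intro order_tendstoD(1)) simp_all
  moreover have "\<forall>\<^sub>F \<theta> in at_left (1::real). 0 < \<theta> \<and> \<theta> < 1"
    using eventually_at_left_real[of 0 1] by simp
  ultimately have "\<forall>\<^sub>F \<theta> in at_left 1. v < card Z * (\<theta> * l) ^ (2 * n) \<and> 0 < \<theta> \<and> \<theta> < 1"
    by (rule eventually_conj)
  then obtain \<theta> where \<theta>: "0 < \<theta>" "\<theta> < 1" "v < card Z * (\<theta> * l) ^ (2 * n)"
    using eventually_happens'[OF trivial_limit_at_left_real] by blast
  define l' where "l' = \<theta> * l"
  have l': "0 < l'" "l' < l" using l \<theta> by (auto simp: l'_def)
  define s where "s = (\<lambda>h. 2 * pi * h / (l' * l))"
  define h1 where "h1 = (1 - \<theta>) * (l' * l) / (2 * pi)"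
  obtain L where L: "L > 0" "\<And>J c a m f. finite J \<Longrightarrow> (a, m :: 'n \<Rightarrow> int) \<in> J \<Longrightarrow>
      f = (\<lambda>x. \<Sum>(a, m)\<in>J. c (a, m) * (cell_bump l a x * character l' m x)) \<Longrightarrow>
      integrable lborel (\<lambda>x. (cmod (f x))\<^sup>2) \<Longrightarrow>
      cmod (c (a, m)) \<le> L * (1 + (\<integral>x. (cmod (f x))\<^sup>2 \<partial>lborel))"
    using wave_packet_coefficient_bound[OF l'] by blast
  have coeff: "cmod (c (a, m)) \<le> L * (1 + (L2_norm (wave_packets l l' J c))\<^sup>2)"
    if "finite J" "(a, m) \<in> J" for J c a and m :: "'n \<Rightarrow> int"
    unfolding L2_norm_square using that
    by (intro L(2)[of J]) (auto simp: wave_packets_def[abs_def, symmetric] integrable_norm_square test_function_wave_packets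
      simp flip: wave_packets_def)
  have "\<exists>G. \<forall>\<psi> k. smooth \<psi> \<longrightarrow> (\<forall>a\<in>fst ` Z. \<forall>z. norm z ^ k * cmod (fourier (\<lambda>x. \<psi> x * cell_bump l a x) z) \<le> G \<psi> k)"
  proof -
    have "\<exists>g. smooth \<psi> \<longrightarrow> (\<forall>a\<in>fst ` Z. \<forall>z. norm z ^ k * cmod (fourier (\<lambda>x. \<psi> x * cell_bump l a x) z) \<le> g)"
      for \<psi> :: "real ^ 'n \<Rightarrow> complex" and k
    proof (cases "smooth \<psi>")
      case True
      have "\<exists>g\<ge>0. \<forall>z. norm z ^ k * cmod (fourier (\<lambda>x. \<psi> x * cell_bump l a x) z) \<le> g" for a
        using fourier_decay[OF test_function_smooth_mult[OF True test_function_cell_bump]] by metis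
      then obtain g where g: "\<And>a. g a \<ge> 0"
        "\<And>a z. norm z ^ k * cmod (fourier (\<lambda>x. \<psi> x * cell_bump l a x) z) \<le> g a" by metis
      have "norm z ^ k * cmod (fourier (\<lambda>x. \<psi> x * cell_bump l a x) z) \<le> sum g (fst ` Z)" if "a \<in> fst ` Z" for a z
        using g Z(1) that by (intro order_trans[OF g(2)] member_le_sum) auto
      then show ?thesis by blast
    qed blast
    then show ?thesis by metis
  qed
  then obtain G where G: "\<And>\<psi> k a z. smooth \<psi> \<Longrightarrow> a \<in> fst ` Z \<Longrightarrow>
      norm z ^ k * cmod (fourier (\<lambda>x. \<psi> x * cell_bump l a x) z) \<le> G \<psi> k" by metis
  define A where "A = (\<lambda>\<psi> k. (card Z * (l' * l / pi) ^ n) * (2 * L * G \<psi> (k + n)))"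
  show thesis
  proof
    show "h1 > 0" using \<theta> l l' by (simp add: h1_def)
  next
    fix h :: real and S :: "(real ^ 'n) set"
    assume h: "0 < h" "h < h1" and S: "finite S" "card S \<le> v / (2 * pi * h) ^ CARD('n)"
    have s: "0 < s h" "s h \<le> 1 - \<theta>"
      using h l l' by (auto simp: s_def h1_def field_simps)
    then have s1: "s h \<le> 1" using \<theta> by simp
    define J where "J = lattice_cells (s h) Z"
    have J: "finite J" "card Z * (1 / s h - 1) ^ n \<le> card J" "card J \<le> card Z * (1 / s h + 1) ^ n"
      unfolding J_def n_def using s s1 Z(1) by (simp_all add: card_lattice_cells)
    have cardJ: "card J \<le> card Z * (l' * l / pi) ^ n / h ^ n"
    proof -
      have "(1 / s h + 1) ^ n \<le> (2 / s h) ^ n"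
        using s s1 by (intro power_mono) (auto simp: field_simps)
      also have "2 / s h = (l' * l / pi) / h" using h by (simp add: s_def)
      finally have "card Z * (1 / s h + 1) ^ n \<le> card Z * ((l' * l / pi) / h) ^ n"
        by (intro mult_left_mono) auto
      then show ?thesis using J(3) by (simp add: power_divide power_mult_distrib)
    qed
    have "card S < card J"
    proof -
      have "v / (2 * pi * h) ^ n < card Z * (\<theta> * l) ^ (2 * n) / (2 * pi * h) ^ n"
        using \<theta>(3) h by (intro divide_strict_right_mono) auto
      also have "\<dots> = card Z * (\<theta> / s h) ^ n"
        using h by (simp add: s_def l'_def power_mult power_divide power_mult_distrib power2_eq_square field_simps)
      also have "\<dots> \<le> card Z * (1 / s h - 1) ^ n"
        using s \<theta> by (intro mult_left_mono power_mono) (auto simp: field_simps)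
      finally show ?thesis using J(2) S(2) by (simp add: n_def)
    qed
    then obtain c0 where c0: "\<exists>p\<in>J. c0 p \<noteq> 0"
        "\<And>x. x \<in> S \<Longrightarrow> (\<Sum>p\<in>J. c0 p * (cell_bump l (fst p) x * character l' (snd p) x)) = 0"
      using homogeneous_system_nontrivial_solution[OF S(1) J(1),
          of "\<lambda>x p. cell_bump l (fst p) x * character l' (snd p) x"] by blast
    define I where "I = L2_norm (wave_packets l l' J c0)"
    have scale: "wave_packets l l' J (\<lambda>p. t * c0 p) = (\<lambda>x. t * wave_packets l l' J c0 x)" for t
      by (auto simp: wave_packets_def sum_distrib_left mult_ac fun_eq_iff intro!: sum.cong)
    have L2_scale: "(L2_norm (wave_packets l l' J (\<lambda>p. t * c0 p)))\<^sup>2 = (cmod t)\<^sup>2 * I\<^sup>2" for t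
      by (simp add: L2_norm_square I_def scale norm_mult power_mult_distrib)
    (* A combination of packets with zero norm would satisfy the coefficient bound after
       multiplication by any scalar. *)
    have I: "I > 0"
    proof (rule ccontr)
      assume "\<not> I > 0"
      moreover have "I \<ge> 0" by (simp add: I_def L2_norm_def)
      ultimately have "I = 0" by simp
      obtain a m where am: "(a, m) \<in> J" "c0 (a, m) \<noteq> 0" using c0(1) by auto
      have "t * cmod (c0 (a, m)) \<le> L" if "t > 0" for t :: real
        using coeff[OF J(1) am(1), of "\<lambda>p. complex_of_real t * c0 p"] that \<open>I = 0\<close>
        by (simp add: L2_scale norm_mult del: of_real_mult)
      from this[of "2 * L / cmod (c0 (a, m))"] show False using am(2) L(1) by simp
    qed
    define c where "c = (\<lambda>p. complex_of_real (1 / I) * c0 p)"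
    define f where "f = wave_packets l l' J c"
    have "(L2_norm f)\<^sup>2 = 1"
      using I L2_scale[of "complex_of_real (1 / I)"] by (simp add: f_def c_def norm_divide power_divide)
    moreover have "L2_norm f \<ge> 0" by (simp add: L2_norm_def)
    ultimately have f1: "L2_norm f = 1" by (simp add: power2_eq_1_iff)
    have c: "cmod (c p) \<le> 2 * L" if "p \<in> J" for p
      using coeff[OF J(1), of "fst p" "snd p" c] that f1 by (simp add: f_def mult.commute)
    have cell: "\<exists>b. (a, b) \<in> Z \<and> h *\<^sub>R freq l' m \<in> cube l b" if "(a, m) \<in> J" for a m
      using lattice_cells_freq_mem_cube[of a m h l' l Z] that l l' unfolding J_def s_def by blast
    have "{x. f x \<noteq> 0} \<subseteq> fst ` U"
    proof clarify
      fix x assume "f x \<noteq> 0"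
      then obtain a m where am: "(a, m) \<in> J" "x \<in> cube l a"
        unfolding f_def by (rule wave_packets_nonzeroD)
      then obtain b where "(a, b) \<in> Z" "h *\<^sub>R freq l' m \<in> cube l b" using cell by blast
      then show "x \<in> fst ` U" using Z(2)[of a b] am(2) by force
    qed
    then have supp: "supp f \<subseteq> closure (fst ` U)" unfolding supp_def by (rule closure_mono)
    have "f x = 0" if "x \<in> S" for x
      using c0(2)[OF that] scale[of "complex_of_real (1 / I)"]
      by (simp add: f_def c_def) (simp add: wave_packets_def case_prod_unfold)
    moreover have "cmod (fourier_h h (\<lambda>x. \<psi> x * f x) \<xi>) \<le> A \<psi> k * h ^ k / d ^ (k + n)"
      if \<psi>: "smooth \<psi>" and d: "0 < d" and far: "\<forall>(y, \<eta>)\<in>U. \<psi> y \<noteq> 0 \<longrightarrow> d \<le> norm (\<xi> - \<eta>)" for \<psi> k \<xi> d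
    proof -
      have far': "d / h \<le> norm (\<xi> /\<^sub>R h - freq l' m)"
        if am: "(a, m) \<in> J" and y: "y \<in> cube l a" "\<psi> y \<noteq> 0" for a m y
      proof -
        obtain b where b: "(a, b) \<in> Z" "h *\<^sub>R freq l' m \<in> cube l b" using cell[OF am] by blast
        then have "(y, h *\<^sub>R freq l' m) \<in> U" using Z(2)[OF b(1)] y(1) by blast
        then have "d \<le> norm (\<xi> - h *\<^sub>R freq l' m)" using far y(2) by blast
        also have "\<xi> - h *\<^sub>R freq l' m = h *\<^sub>R (\<xi> /\<^sub>R h - freq l' m)"
          using h by (simp add: scaleR_diff_right)
        finally have "d \<le> h * norm (\<xi> /\<^sub>R h - freq l' m)"
          using h(1) by (simp only: norm_scaleR abs_of_pos)
        then show ?thesis by (simp only: pos_divide_le_eq[OF h(1)] mult.commute)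
      qed
      have fstJ: "a \<in> fst ` Z" if "a \<in> fst ` J" for a
        using that cell by force
      obtain a0 where a0: "a0 \<in> fst ` J" using c0(1) by blast
      have G0: "0 \<le> G \<psi> (k + n)"
        by (rule order_trans[OF _ G[OF \<psi> fstJ[OF a0], of 0]]) simp
      have "cmod (fourier_h h (\<lambda>x. \<psi> x * f x) \<xi>) \<le> card J * (2 * L * (G \<psi> (k + n) / (d / h) ^ (k + n)))"
        unfolding fourier_h_eq f_def using d h L(1) J(1) \<psi> c fstJ G far'
        by (intro norm_fourier_wave_packets_le) auto
      also have "\<dots> \<le> (card Z * (l' * l / pi) ^ n / h ^ n) * (2 * L * (G \<psi> (k + n) / (d / h) ^ (k + n)))"
        using cardJ L(1) G0 d h by (intro mult_right_mono) auto
      also have "\<dots> = A \<psi> k * h ^ k / d ^ (k + n)"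
        using h d by (simp add: A_def power_add power_divide field_simps)
      finally show ?thesis .
    qed
    ultimately show "\<exists>f. microlocalized A U h f \<and> L2_norm f = 1 \<and> (\<forall>x\<in>S. f x = 0)"
      using supp f1 test_function_wave_packets[OF J(1), of l l' c]
      by (intro exI[of _ f]) (auto simp: microlocalized_def n_def f_def)
  qed
qed

section \<open>Functions concentrating at a compact set\<close>

text \<open>
  If \<open>U\<close> were equal to \<open>K\<close>, it would be open and closed, hence the whole space, which is not bounded.
  So \<open>U - K\<close> is a nonempty open set and has positive measure.
\<close>

lemma measure_interior_less_measure_open_superset:
  fixes K U :: "'a::euclidean_space set"
  assumes "compact K" and "K \<noteq> {}" and "open U" and "bounded U" and "K \<subseteq> U"
  shows "measure lborel (interior K) < measure lborel U"
proof -
  have "U \<noteq> K"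
  proof
    assume "U = K"
    then have "open K \<and> closed K" using assms by (auto simp: compact_imp_closed)
    then have "K = UNIV" using clopen assms(2) by blast
    then show False using assms(1) compact_imp_bounded not_bounded_UNIV by blast
  qed
  then have ne: "U - K \<noteq> {}" and op: "open (U - K)"
    using assms by (auto simp: compact_imp_closed intro!: open_Diff)
  have fin: "S \<in> fmeasurable lborel" if "open S" "bounded S" for S :: "'a set"
    using that emeasure_bounded_finite[of S] by (intro fmeasurableI) (auto simp: infinity_ennreal_def)
  have bdd: "bounded (interior K)" "bounded (U - K)"
    using assms bounded_subset[OF _ interior_subset] by (auto simp: compact_imp_bounded bounded_diff)
  obtain p where p: "p \<in> U - K" using ne by blast
  obtain e where e: "e > 0" "ball p e \<subseteq> U - K"
    using openE[OF op p] by blast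
  obtain a b where ab: "p \<in> box a b" "box a b \<subseteq> U - K"
    using rational_boxes[OF e(1), of p] order_trans[OF _ e(2)] by (elim exE conjE) blast
  then have "box a b \<noteq> {}" by (metis empty_iff)
  then have "0 < measure lborel (box a b)"
    by (simp add: box_ne_empty measure_lborel_box prod_pos inner_diff_left less_imp_le)
  also have "\<dots> \<le> measure lborel (U - K)"
    using ab(2) fin[OF op bdd(2)] by (intro measure_mono_fmeasurable) auto
  finally have "measure lborel (interior K) < measure lborel (interior K) + measure lborel (U - K)" by simp
  also have "\<dots> = measure lborel (interior K \<union> (U - K))"
    using fin[OF open_interior bdd(1)] fin[OF op bdd(2)] interior_subset[of K]
    by (intro measure_Union[symmetric]) (auto simp: fmeasurable_def)
  also have "\<dots> \<le> measure lborel U"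
    using assms fin interior_subset[of K] op by (intro measure_mono_fmeasurable) auto
  finally show ?thesis .
qed

lemma countable_rational_points: "countable {a :: 'a::euclidean_space. \<forall>i\<in>Basis. a \<bullet> i \<in> \<rat>}"
proof -
  have "a \<in> (\<lambda>f. \<Sum>b\<in>Basis. f b *\<^sub>R b) ` PiE Basis (\<lambda>_. \<rat>)" if "\<forall>i\<in>Basis. a \<bullet> i \<in> \<rat>" for a :: 'a
    using that by (intro image_eqI[of _ _ "restrict ((\<bullet>) a) Basis"]) (auto simp: euclidean_representation)
  then have "{a :: 'a. \<forall>i\<in>Basis. a \<bullet> i \<in> \<rat>} \<subseteq> (\<lambda>f. \<Sum>b\<in>Basis. f b *\<^sub>R b) ` PiE Basis (\<lambda>_. \<rat>)"
    by blast
  moreover have "countable (PiE (Basis :: 'a set) (\<lambda>_. \<rat> :: real set))"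
    by (intro countable_PiE finite_Basis countable_rat)
  ultimately show ?thesis
    using countable_image countable_subset by blast
qed

text \<open>
  A list of the constant \<open>1\<close>, which serves to express band limitation, and of all bumps on boxes with
  rational corners. Being countable, the list can be handled by a diagonal argument.
\<close>

definition cutoff :: "nat \<Rightarrow> real ^ 'n \<Rightarrow> complex" where
  "cutoff i = (case i of 0 \<Rightarrow> (\<lambda>x. 1)
     | Suc i \<Rightarrow> (let r = from_nat_into {a. \<forall>i\<in>Basis. a \<bullet> i \<in> \<rat>} in
         bump (r (fst (prod_decode i))) (r (snd (prod_decode i)))))"

lemma cutoff_0: "cutoff 0 = (\<lambda>x. 1)"
  by (simp add: cutoff_def)

lemma smooth_cutoff: "smooth (cutoff i)"
  by (cases i) (simp_all add: cutoff_def smooth_bump Let_def)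

lemma exists_cutoff:
  fixes x :: "real ^ 'n"
  assumes "e > 0"
  obtains i where "test_function (cutoff i :: real ^ 'n \<Rightarrow> complex)" and "cutoff i x \<noteq> 0"
    and "\<And>y. cutoff i y \<noteq> 0 \<Longrightarrow> dist x y < e"
proof -
  let ?D = "{a :: real ^ 'n. \<forall>i\<in>Basis. a \<bullet> i \<in> \<rat>}"
  obtain a b where ab: "a \<in> ?D" "b \<in> ?D" "x \<in> box a b" "box a b \<subseteq> ball x e"
    using rational_boxes[OF assms, of x] by blast
  obtain j where j: "from_nat_into ?D j = a"
    using from_nat_into_surj[OF countable_rational_points ab(1)] by blast
  obtain k where k: "from_nat_into ?D k = b"
    using from_nat_into_surj[OF countable_rational_points ab(2)] by blast
  have eq: "cutoff (Suc (prod_encode (j, k))) = bump a b"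
    by (simp add: cutoff_def j k)
  have "compact (supp (bump a b))"
    by (rule compact_suppI[OF compact_cbox[of a b]]) (use bump_eq_0_iff box_subset_cbox in blast)
  then have "test_function (bump a b)" by (simp add: test_function_iff smooth_bump)
  moreover have "bump a b x \<noteq> 0" using ab(3) by (simp add: bump_eq_0_iff)
  moreover have "dist x y < e" if "bump a b y \<noteq> 0" for y
  proof -
    have "y \<in> box a b" using that bump_eq_0_iff by blast
    then show ?thesis using ab(4) by auto
  qed
  ultimately show thesis unfolding eq[symmetric] by (rule that)
qed

text \<open>
  The pointwise bound \<open>|f| \<le> 1 + |f|\<^sup>2\<close> on the support compares the \<open>L\<^sup>1\<close> norm with the \<open>L\<^sup>2\<close> norm.
\<close>

lemma norm_fourier_le_of_unit:
  fixes f :: "real ^ 'n \<Rightarrow> complex"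
  assumes "test_function f" and "L2_norm f = 1" and "compact S" and "supp f \<subseteq> S"
  shows "cmod (fourier f z) \<le> measure lborel S + 1"
proof -
  have int: "integrable lborel (indicator S :: _ \<Rightarrow> real)"
    using assms(3) emeasure_compact_finite[of S] by (simp add: integrable_indicator_iff compact_imp_closed)
  have "cmod (fourier f z) \<le> (\<integral>x. cmod (f x) \<partial>lborel)" by (rule norm_fourier_le)
  also have "\<dots> \<le> (\<integral>x. indicator S x + (cmod (f x))\<^sup>2 \<partial>lborel)"
  proof (rule integral_mono')
    show "integrable lborel (\<lambda>x. indicator S x + (cmod (f x))\<^sup>2)"
      using int integrable_norm_square[OF assms(1)] by simp
    show "cmod (f x) \<le> indicator S x + (cmod (f x))\<^sup>2" for x
    proof (cases "x \<in> S")
      case True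
      have "cmod (f x) \<le> 1 + (cmod (f x))\<^sup>2"
        using zero_le_power2[of "cmod (f x) - 1"] by (simp add: power2_diff) (smt (verit) norm_ge_zero)
      with True show ?thesis by simp
    next
      case False
      then have "f x = 0" using assms(4) not_in_supp by blast
      then show ?thesis by simp
    qed
  qed (simp add: indicator_def)
  also have "\<dots> = measure lborel S + 1"
    using int integrable_norm_square[OF assms(1)] L2_norm_square[of f] assms(2,3)
    by (simp add: compact_imp_closed)
  finally show ?thesis .
qed

text \<open>
  A bounded transform is square integrable against the weight \<open>\<langle>\<xi>\<rangle>\<^sup>-\<^sup>2\<^sup>n\<close>, so in the Sobolev
  norm of order \<open>-n\<close> only the normalizing factor \<open>(2\<pi>h)\<^sup>-\<^sup>n\<close> grows.
\<close>

lemma tempered_of_bounded_fourier: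
  fixes f :: "real \<Rightarrow> real ^ 'n \<Rightarrow> complex"
  assumes W: "\<And>h \<xi>. h > 0 \<Longrightarrow> cmod (fourier_h h (f h) \<xi>) \<le> W"
  shows "tempered f"
proof -
  define s where "s = - real CARD('n)"
  define I where "I = (\<integral>\<xi>. japanese (\<xi> :: real ^ 'n) powr (2 * s) \<partial>lborel)"
  have int: "integrable lborel (\<lambda>\<xi> :: real ^ 'n. japanese \<xi> powr (2 * s))"
    unfolding s_def by (rule integrable_japanese)
  have I: "I \<ge> 0" unfolding I_def by (simp add: japanese_def)
  have bound: "sobolev_norm_h h s (f h) \<le> sqrt (W\<^sup>2 * I) * h powr (- real CARD('n))" if h: "0 < h" "h < 1" for h
  proof -
    have "(\<integral>\<xi>. japanese \<xi> powr (2 * s) * (cmod (fourier_h h (f h) \<xi>))\<^sup>2 \<partial>lborel)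
        \<le> (\<integral>\<xi>. W\<^sup>2 * japanese (\<xi> :: real ^ 'n) powr (2 * s) \<partial>lborel)"
    proof (rule integral_mono')
      show "japanese \<xi> powr (2 * s) * (cmod (fourier_h h (f h) \<xi>))\<^sup>2 \<le> W\<^sup>2 * japanese \<xi> powr (2 * s)" for \<xi>
        using mult_right_mono[OF power_mono[OF W[OF h(1), of \<xi>], of 2], of "japanese \<xi> powr (2 * s)"]
        by (simp add: mult.commute[of "(cmod (fourier_h h (f h) \<xi>))\<^sup>2"])
    qed (use int in auto)
    also have "\<dots> = W\<^sup>2 * I" by (simp add: I_def)
    finally have "sobolev_norm_h h s (f h) \<le> sqrt (1 / (2 * pi * h) ^ CARD('n) * (W\<^sup>2 * I))"
      unfolding sobolev_norm_h_def using h by (intro real_sqrt_le_mono mult_left_mono) auto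
    also have "\<dots> \<le> sqrt ((h powr (- real CARD('n)))\<^sup>2 * (W\<^sup>2 * I))"
    proof (intro real_sqrt_le_mono mult_right_mono)
      have "1 \<le> 2 * pi" using pi_gt3 by simp
      then have "h \<le> 2 * pi * h" using h by simp
      then have "h\<^sup>2 \<le> 2 * pi * h" using h by (smt (verit) power2_eq_square mult_left_le)
      then have "(h\<^sup>2) ^ CARD('n) \<le> (2 * pi * h) ^ CARD('n)" by (intro power_mono) auto
      then have "1 / (2 * pi * h) ^ CARD('n) \<le> 1 / (h\<^sup>2) ^ CARD('n)"
        using h by (intro divide_left_mono) auto
      also have "\<dots> = (h powr (- real CARD('n)))\<^sup>2"
        using h by (simp add: powr_minus powr_realpow power_inverse divide_inverse flip: power_mult) (simp add: mult.commute)
      finally show "1 / (2 * pi * h) ^ CARD('n) \<le> (h powr (- real CARD('n)))\<^sup>2" .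
    qed (use I in auto)
    finally show ?thesis by (simp add: real_sqrt_mult mult.commute)
  qed
  have "(\<lambda>h. sobolev_norm_h h s (f h)) \<in> O[at_right 0](\<lambda>h. h powr (- real CARD('n)))"
  proof (rule bigoI)
    have "\<forall>\<^sub>F h in at_right (0::real). 0 < h \<and> h < 1"
      using eventually_at_right_real[of 0 1] by simp
    then show "\<forall>\<^sub>F h in at_right 0. norm (sobolev_norm_h h s (f h)) \<le> sqrt (W\<^sup>2 * I) * norm (h powr (- real CARD('n)))"
    proof (rule eventually_mono)
      fix h :: real assume h: "0 < h \<and> h < 1"
      have "0 \<le> sobolev_norm_h h s (f h)" using h by (simp add: sobolev_norm_h_def)
      then show "norm (sobolev_norm_h h s (f h)) \<le> sqrt (W\<^sup>2 * I) * norm (h powr (- real CARD('n)))"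
        using bound[of h] h by simp
    qed
  qed
  then show ?thesis unfolding tempered_def by blast
qed

definition neighbourhood :: "'a::metric_space set \<Rightarrow> nat \<Rightarrow> 'a set" where
  "neighbourhood K j = {p. infdist p K < 1 / (real j + 1)}"

lemma neighbourhood_subset: "K \<subseteq> neighbourhood K j"
  by (auto simp: neighbourhood_def)

lemma neighbourhood_antimono: "i \<le> j \<Longrightarrow> neighbourhood K j \<subseteq> neighbourhood K i"
  by (auto simp: neighbourhood_def elim!: order.strict_trans2 intro!: divide_left_mono)

lemma open_neighbourhood: "open (neighbourhood K j)"
  unfolding neighbourhood_def by (intro open_Collect_less continuous_intros)

lemma mem_neighbourhoodE:
  assumes "p \<in> neighbourhood K j" and "K \<noteq> {}"
  obtains q where "q \<in> K" and "dist p q < 1 / (real j + 1)"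
proof -
  have "(INF q\<in>K. dist p q) < 1 / (real j + 1)"
    using assms by (simp add: neighbourhood_def infdist_notempty)
  then have "\<exists>q\<in>K. dist p q < 1 / (real j + 1)"
    using assms(2) by (subst (asm) cINF_less_iff) (auto intro!: bdd_belowI[of _ 0])
  then show thesis using that by blast
qed

lemma bounded_neighbourhood:
  assumes "bounded K" and "K \<noteq> {}"
  shows "bounded (neighbourhood K j)"
proof -
  obtain a R where R: "\<And>q. q \<in> K \<Longrightarrow> dist a q \<le> R" using assms(1) unfolding bounded_def by blast
  have "dist a p \<le> R + 1 / (real j + 1)" if p: "p \<in> neighbourhood K j" for p
  proof -
    obtain q where "q \<in> K" "dist p q < 1 / (real j + 1)" using p assms(2) by (rule mem_neighbourhoodE)
    then show ?thesis using R[of q] dist_triangle2[of a p q] by linarith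
  qed
  then show ?thesis unfolding bounded_def by blast
qed

text \<open>
  A function \<open>g j\<close> for each parameter of a sequence \<open>H j\<close>. The last assumption is the diagonal
  choice: the constants of index up to \<open>j\<close> may be replaced by \<open>1\<close> at the cost of one power of
  \<open>h\<close>.
\<close>

locale concentrating_sequence =
  fixes K :: "((real ^ 'n) \<times> (real ^ 'n)) set"
    and H :: "nat \<Rightarrow> real"
    and g :: "nat \<Rightarrow> real ^ 'n \<Rightarrow> complex"
    and A :: "nat \<Rightarrow> (real ^ 'n \<Rightarrow> complex) \<Rightarrow> nat \<Rightarrow> real"
  assumes K: "compact K" "K \<noteq> {}"
    and H_pos: "H j > 0" and H_less: "H (Suc j) < H j"
    and g: "microlocalized (A j) (neighbourhood K j) (H j) (g j)"
    and unit: "L2_norm (g j) = 1"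
    and A_H: "\<lbrakk>i \<le> j; k \<le> j\<rbrakk> \<Longrightarrow> A j (cutoff i) k * H j \<le> 1"
begin

text \<open>Families are indexed by all \<open>h\<close>; zero is a harmless value off the sequence.\<close>

definition family :: "real \<Rightarrow> real ^ 'n \<Rightarrow> complex" where
  "family h = (if h \<in> range H then g (inv H h) else (\<lambda>x. 0))"

lemma H_less_iff: "H i < H j \<longleftrightarrow> j < i"
proof -
  have "strict_mono (\<lambda>j. - H j)" by (simp add: strict_mono_Suc_iff H_less)
  then show ?thesis by (auto simp: strict_mono_less dest: strict_mono_less[of _ j i])
qed

lemma family_H: "family (H j) = g j"
proof -
  have "inj H" by (rule injI) (metis H_less_iff linorder_neqE_nat less_irrefl)
  then show ?thesis by (simp add: family_def)
qed

lemma family_cases: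
  obtains j where "h = H j" "family h = g j" | "family h = (\<lambda>x. 0)"
  using family_H unfolding family_def by (cases "h \<in> range H") auto

lemma test_function_g: "test_function (g j)"
  using g[of j] by (simp add: microlocalized_def)

lemma fourier_g_le:
  assumes "0 < d" and "\<And>y \<eta>. (y, \<eta>) \<in> neighbourhood K j \<Longrightarrow> cutoff i y \<noteq> 0 \<Longrightarrow> d \<le> norm (\<xi> - \<eta>)"
  shows "cmod (fourier_h (H j) (\<lambda>x. cutoff i x * g j x) \<xi>) \<le> A j (cutoff i) k * H j ^ k / d ^ (k + CARD('n))"
  using g[of j] assms smooth_cutoff[of i] unfolding microlocalized_def by blast

text \<open>
  All frequencies stay in a ball of radius \<open>R/2\<close>, so \<open>|\<xi>| > R\<close> has distance at least \<open>|\<xi>|/2\<close> from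
  them, which is comparable to \<open>\<langle>\<xi>\<rangle>\<close>.
\<close>

lemma band_limited_family: "band_limited h0 family"
proof -
  define S where "S = closure (fst ` neighbourhood K 0)"
  have bdd: "bounded (neighbourhood K 0)"
    using K by (simp add: bounded_neighbourhood compact_imp_bounded)
  then have S: "compact S" by (simp add: S_def bounded_fst)
  have supp_g: "supp (g j) \<subseteq> S" for j
  proof -
    have "supp (g j) \<subseteq> closure (fst ` neighbourhood K j)" using g[of j] by (simp add: microlocalized_def)
    also have "\<dots> \<subseteq> S" unfolding S_def by (intro closure_mono image_mono neighbourhood_antimono) simp
    finally show ?thesis .
  qed
  have supp: "supp (family h) \<subseteq> S" for h
    by (cases rule: family_cases[of h]) (simp_all add: supp_g, simp add: supp_def)
  have test: "test_function (family h)" for h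
    by (cases rule: family_cases[of h])
      (simp_all add: test_function_g, simp add: test_function_iff supp_def)
  have tempered: "tempered family"
  proof (rule tempered_of_bounded_fourier)
    show "cmod (fourier_h h (family h) \<xi>) \<le> measure lborel S + 1" for h \<xi>
    proof (cases rule: family_cases[of h])
      case (1 j)
      then show ?thesis
        using norm_fourier_le_of_unit[OF test_function_g unit S supp_g] by (simp add: fourier_h_eq)
    qed (simp add: fourier_h_def)
  qed
  obtain R where R: "R \<ge> 2" "\<And>y \<eta>. (y, \<eta>) \<in> neighbourhood K 0 \<Longrightarrow> norm \<eta> \<le> R / 2"
  proof -
    obtain r where "\<And>p. p \<in> neighbourhood K 0 \<Longrightarrow> norm p \<le> r"
      using bdd bounded_iff by metis
    then have "norm \<eta> \<le> r" if "(y, \<eta>) \<in> neighbourhood K 0" for y \<eta>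
      using that norm_snd_le[of \<eta> y] order_trans by blast
    then have "norm \<eta> \<le> max 2 (2 * r) / 2" if "(y, \<eta>) \<in> neighbourhood K 0" for y \<eta>
      using that by fastforce
    then show thesis using that[of "max 2 (2 * r)"] by simp
  qed
  have "\<exists>T. \<forall>h\<in>{0<..<h0}. \<forall>\<xi>. \<xi> \<notin> W \<longrightarrow>
      cmod (fourier_h h (family h) \<xi>) \<le> T * h ^ M * japanese \<xi> powr (- real M)"
    if W: "cball 0 R \<subseteq> W" for W and M :: nat
  proof -
    (* The diagonal bound on A j covers only j > M; the finitely many remaining j are included by
       hand, because the estimate is required for all h and not only for small ones. *)
    define T where "T = 1 + (\<Sum>j\<le>M. \<bar>A j (cutoff 0) (Suc M) * H j\<bar>)"
    have T: "T \<ge> 1" by (simp add: T_def sum_nonneg)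
    have AT: "A j (cutoff 0) (Suc M) * H j \<le> T" for j
    proof (cases "j \<le> M")
      case True
      then have "\<bar>A j (cutoff 0) (Suc M) * H j\<bar> \<le> (\<Sum>j\<le>M. \<bar>A j (cutoff 0) (Suc M) * H j\<bar>)"
        by (intro member_le_sum) auto
      then show ?thesis unfolding T_def by linarith
    next
      case False
      then have "A j (cutoff 0) (Suc M) * H j \<le> 1" by (intro A_H) auto
      then show ?thesis using T by linarith
    qed
    have "cmod (fourier_h h (family h) \<xi>) \<le> (T * 4 ^ M) * h ^ M * japanese \<xi> powr (- real M)"
      if h: "h > 0" and \<xi>: "\<xi> \<notin> W" for h \<xi>
    proof (cases rule: family_cases[of h])
      case (1 j)
      define d where "d = norm \<xi> / 2"
      have norm: "norm \<xi> > R" using \<xi> W by (auto simp: subset_iff not_le[symmetric])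
      then have d: "d \<ge> 1" "d > 0" using R(1) by (auto simp: d_def)
      have far: "d \<le> norm (\<xi> - \<eta>)" if "(y, \<eta>) \<in> neighbourhood K j" for y \<eta>
      proof -
        have "norm \<eta> \<le> R / 2" using R(2) that neighbourhood_antimono[of 0 j K] by blast
        then show ?thesis using norm norm_triangle_ineq2[of \<xi> \<eta>] by (simp add: d_def)
      qed
      have "cmod (fourier_h h (family h) \<xi>) \<le> A j (cutoff 0) (Suc M) * H j ^ Suc M / d ^ (Suc M + CARD('n))"
        using fourier_g_le[OF d(2), of j 0 \<xi> "Suc M"] far 1 by (simp add: cutoff_0)
      also have "\<dots> = (A j (cutoff 0) (Suc M) * H j) * (H j ^ M / d ^ (Suc M + CARD('n)))"
        by simp
      also have "\<dots> \<le> T * (H j ^ M / d ^ M)"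
        using T AT[of j] H_pos[of j] d by (intro mult_mono divide_left_mono power_increasing) auto
      also have "\<dots> \<le> T * (H j ^ M * (4 ^ M * japanese \<xi> powr (- real M)))"
      proof -
        have "japanese \<xi> \<le> 4 * d" using japanese_bounds(2)[of \<xi>] norm R(1) by (simp add: d_def)
        then have "1 / d \<le> 4 / japanese \<xi>" using d japanese_bounds(1)[of \<xi>] by (simp add: field_simps)
        then have "(1 / d) ^ M \<le> (4 / japanese \<xi>) ^ M" using d by (intro power_mono) auto
        then have "1 / d ^ M \<le> 4 ^ M * japanese \<xi> powr (- real M)"
          using japanese_bounds(1)[of \<xi>] by (simp add: power_divide powr_minus powr_realpow divide_inverse power_inverse)
        then have "H j ^ M * (1 / d ^ M) \<le> H j ^ M * (4 ^ M * japanese \<xi> powr (- real M))"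
          using H_pos[of j] by (intro mult_left_mono) auto
        then show ?thesis using T by (intro mult_left_mono) auto
      qed
      finally show ?thesis using 1 by (simp add: mult_ac)
    qed (use h T in \<open>simp add: fourier_h_def\<close>)
    then show ?thesis by (intro exI[of _ "T * 4 ^ M"]) auto
  qed
  then have band: "\<exists>B. compact B \<and> (\<forall>U. open U \<and> B \<subseteq> U \<longrightarrow> (\<forall>M::nat. M > 0 \<longrightarrow>
      (\<exists>A. \<forall>h\<in>{0<..<h0}. \<forall>\<xi>. \<xi> \<notin> U \<longrightarrow>
        cmod (fourier_h h (family h) \<xi>) \<le> A * h ^ M * japanese \<xi> powr (- real M))))"
    by (intro exI[of _ "cball 0 R"]) (simp add: compact_cball)
  show ?thesis
    unfolding band_limited_def by (intro conjI ballI exI[of _ S] test S supp tempered band)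
qed

text \<open>
  If \<open>(x0, \<xi>0)\<close> has distance \<open>e\<close> from \<open>K\<close>, then for large \<open>j\<close> the points of the \<open>j\<close>-th neighbourhood
  lying over an \<open>e/4\<close>-ball at \<open>x0\<close> have covectors at distance at least \<open>e/4\<close> from the
  \<open>e/4\<close>-ball at \<open>\<xi>0\<close>. A cutoff from the list supported near \<open>x0\<close> then shows that the
  family is negligible there.
\<close>

lemma WF_h_family: "WF_h family \<subseteq> K"
proof
  fix p assume p: "p \<in> WF_h family"
  obtain x0 \<xi>0 where x0: "p = (x0, \<xi>0)" by (cases p)
  show "p \<in> K"
  proof (rule ccontr)
    assume "p \<notin> K"
    then obtain e where e: "e > 0" "\<And>q. q \<in> K \<Longrightarrow> e \<le> dist p q"
      using separate_point_closed[OF compact_imp_closed[OF K(1)], of p] by blast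
    define d where "d = e / 4"
    have d: "d > 0" using e by (simp add: d_def)
    obtain i where i: "test_function (cutoff i :: real ^ 'n \<Rightarrow> complex)" "cutoff i x0 \<noteq> 0" "\<And>y. cutoff i y \<noteq> 0 \<Longrightarrow> dist x0 y < d"
      using exists_cutoff[OF d] by metis
    obtain J0 :: nat where J0: "1 / (real J0 + 1) < d"
      using reals_Archimedean[OF d] by (auto simp: inverse_eq_divide add.commute)
    have far: "d \<le> norm (\<xi> - \<eta>)"
      if "j \<ge> J0" "\<xi> \<in> ball \<xi>0 d" "(y, \<eta>) \<in> neighbourhood K j" "cutoff i y \<noteq> 0" for j \<xi> y \<eta>
    proof -
      have "(y, \<eta>) \<in> neighbourhood K J0" using that neighbourhood_antimono by blast
      then obtain q where q: "q \<in> K" "dist (y, \<eta>) q < 1 / (real J0 + 1)"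
        using K(2) by (rule mem_neighbourhoodE)
      have "e \<le> dist p (y, \<eta>) + dist (y, \<eta>) q"
        using e(2)[OF q(1)] dist_triangle[of p q "(y, \<eta>)"] by linarith
      also have "dist p (y, \<eta>) \<le> dist x0 y + dist \<xi>0 \<eta>"
        unfolding x0 dist_Pair_Pair by (rule sqrt_sum_squares_le_sum) auto
      finally have "e \<le> dist x0 y + dist \<xi>0 \<eta> + dist (y, \<eta>) q" by simp
      moreover have "dist \<xi>0 \<eta> \<le> dist \<xi>0 \<xi> + norm (\<xi> - \<eta>)"
        using dist_triangle[of \<xi>0 \<eta> \<xi>] by (simp add: dist_norm)
      moreover have "dist \<xi>0 \<xi> < d" "dist x0 y < d" using that i(3) by auto
      ultimately show ?thesis using q(2) J0 unfolding d_def by linarith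
    qed
    have "\<exists>B. \<forall>\<^sub>F h in at_right 0. \<forall>\<xi>\<in>ball \<xi>0 d.
        cmod (fourier_h h (\<lambda>x. cutoff i x * family h x) \<xi>) \<le> B * h ^ M" for M :: nat
    proof (intro exI)
      (* Order M + 1 is used so that one factor H j is left to cancel the constant A j. *)
      define J where "J = max (max i (Suc M)) J0"
      have "\<forall>\<^sub>F h in at_right 0. 0 < h \<and> h < H J"
        using eventually_at_right_real[OF H_pos[of J]] by simp
      then show "\<forall>\<^sub>F h in at_right 0. \<forall>\<xi>\<in>ball \<xi>0 d.
          cmod (fourier_h h (\<lambda>x. cutoff i x * family h x) \<xi>) \<le> 1 / d ^ (Suc M + CARD('n)) * h ^ M"
      proof (rule eventually_mono, intro ballI)
        fix h \<xi> assume h: "0 < h \<and> h < H J" and \<xi>: "\<xi> \<in> ball \<xi>0 d"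
        show "cmod (fourier_h h (\<lambda>x. cutoff i x * family h x) \<xi>) \<le> 1 / d ^ (Suc M + CARD('n)) * h ^ M"
        proof (cases rule: family_cases[of h])
          case (1 j)
          then have j: "i \<le> j" "Suc M \<le> j" "J0 \<le> j" using h H_less_iff[of j J] by (auto simp: J_def)
          have "cmod (fourier_h h (\<lambda>x. cutoff i x * family h x) \<xi>)
              \<le> A j (cutoff i) (Suc M) * H j ^ Suc M / d ^ (Suc M + CARD('n))"
            unfolding 1(2) unfolding 1(1) by (rule fourier_g_le[OF d far[OF j(3) \<xi>]])
          also have "\<dots> = (A j (cutoff i) (Suc M) * H j) * (H j ^ M / d ^ (Suc M + CARD('n)))" by simp
          also have "\<dots> \<le> 1 * (H j ^ M / d ^ (Suc M + CARD('n)))"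
            using A_H[OF j(1,2)] H_pos[of j] d by (intro mult_right_mono) auto
          finally show ?thesis using 1 by simp
        qed (use h d in \<open>simp add: fourier_h_def\<close>)
      qed
    qed
    then have "\<exists>V. open V \<and> \<xi>0 \<in> V \<and> (\<forall>M::nat. \<exists>B. \<forall>\<^sub>F h in at_right 0. \<forall>\<xi>\<in>V.
        cmod (fourier_h h (\<lambda>x. cutoff i x * family h x) \<xi>) \<le> B * h ^ M)"
      using d by (intro exI[of _ "ball \<xi>0 d"]) simp
    then have "p \<notin> WF_h family"
      using i(1,2) unfolding WF_h_def x0 by auto
    then show False using p by contradiction
  qed
qed

end

section \<open>The lower bound on the number of sampling points\<close>

theorem theorem5p1:
  fixes h0 C :: real
    and N :: "real \<Rightarrow> nat"
    and x :: "real \<Rightarrow> nat \<Rightarrow> real ^ 'n"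
    and K :: "((real ^ 'n) \<times> (real ^ 'n)) set"
  assumes "h0 > 0" and "C > 0"
    and "compact K"
    and "\<And>f :: real \<Rightarrow> real ^ 'n \<Rightarrow> complex. band_limited h0 f \<Longrightarrow> WF_h f \<subseteq> K \<Longrightarrow>
      \<exists>r. O_h_infinity r \<and>
        (\<forall>h\<in>{0<..<h0}. (L2_norm (f h))\<^sup>2 \<le> C * (\<Sum>j=1..N h. (cmod (f h (x h j)))\<^sup>2) + r h)"
  shows "\<exists>r. r \<in> o[at_right 0](\<lambda>h. h) \<and>
    (\<forall>h\<in>{0<..<h0}.
      real (N h) \<ge> 1 / (2 * pi * h) ^ CARD('n) * measure lborel (interior K) * (1 - r h))"
proof -
  define V where "V = measure lborel (interior K)"
  show ?thesis
  proof (cases "V = 0")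
    case True
    then show ?thesis by (intro exI[of _ "\<lambda>h. 0"]) (simp add: V_def)
  next
    case False
    then have V: "V > 0" unfolding V_def by (simp add: less_le)
    then have "interior K \<noteq> {}" by (auto simp: V_def)
    then have Kne: "K \<noteq> {}" using interior_subset by blast
    define P where "P = (\<lambda>h. V / (2 * pi * h) ^ CARD('n) \<le> N h)"
    have ev: "\<forall>\<^sub>F h in at_right 0. P h"
    proof (rule ccontr)
      assume notP: "\<not> (\<forall>\<^sub>F h in at_right 0. P h)"
      have "\<exists>A h1. h1 > 0 \<and> (\<forall>h S. 0 < h \<longrightarrow> h < h1 \<longrightarrow> finite S \<longrightarrow> card S \<le> V / (2 * pi * h) ^ CARD('n) \<longrightarrow>
          (\<exists>f. microlocalized A (neighbourhood K j) h f \<and> L2_norm f = 1 \<and> (\<forall>x\<in>S. f x = 0)))" for j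
      proof -
        have U: "open (neighbourhood K j)" "bounded (neighbourhood K j)"
          using Kne assms(3) by (simp_all add: open_neighbourhood bounded_neighbourhood compact_imp_bounded)
        then have "V < measure lborel (neighbourhood K j)"
          unfolding V_def using Kne assms(3) neighbourhood_subset
          by (intro measure_interior_less_measure_open_superset) auto
        with U show ?thesis by (rule microlocalized_functions_vanishing_on) blast
      qed
      then obtain A h1 where h1: "\<And>j. h1 j > 0"
        and A: "\<And>j h S. 0 < h \<Longrightarrow> h < h1 j \<Longrightarrow> finite S \<Longrightarrow> card S \<le> V / (2 * pi * h) ^ CARD('n) \<Longrightarrow>
          \<exists>f. microlocalized (A j) (neighbourhood K j) h f \<and> L2_norm f = 1 \<and> (\<forall>x\<in>S. f x = 0)"
        by metis
      (* The requirements on the j-th parameter: too few sampling points, and small enough for all the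
         estimates of index up to j. Only the first one is not satisfied by every small h. *)
      define ok where "ok = (\<lambda>j h. \<not> P h \<and> (0 < h \<and> h < min h0 (min (h1 j) (1 / (real j + 1)))) \<and>
        (\<forall>i\<in>{..j}. \<forall>k\<in>{..j}. A j (cutoff i) k * h < 1))"
      have ok_ex: "\<exists>h. ok j h \<and> h < b" if "b > 0" for j b
      proof -
        have "0 < min b (min h0 (min (h1 j) (1 / (real j + 1))))"
          using that h1[of j] assms(1) by simp
        then have "\<forall>\<^sub>F h in at_right 0. 0 < h \<and> h < min b (min h0 (min (h1 j) (1 / (real j + 1))))"
          using eventually_at_right_real[of 0 "min b (min h0 (min (h1 j) (1 / (real j + 1))))"] by simp
        moreover have "\<forall>\<^sub>F h in at_right 0. \<forall>i\<in>{..j}. \<forall>k\<in>{..j}. A j (cutoff i) k * h < 1"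
        proof (intro eventually_ball_finite ballI finite_atMost)
          fix i k
          have "((\<lambda>h. A j (cutoff i) k * h) \<longlongrightarrow> A j (cutoff i) k * 0) (at_right 0)"
            by (intro tendsto_intros)
          then show "\<forall>\<^sub>F h in at_right 0. A j (cutoff i) k * h < 1"
            by (rule order_tendstoD(2)) simp
        qed
        ultimately have imp: "\<forall>\<^sub>F h in at_right 0. \<not> (ok j h \<and> h < b) \<longrightarrow> P h"
          by eventually_elim (auto simp: ok_def)
        have "\<forall>\<^sub>F h in at_right 0. P h" if "\<nexists>h. ok j h \<and> h < b"
          using imp by (rule eventually_mono) (use that in blast)
        then show ?thesis using notP by blast
      qed
      have "\<exists>H. \<forall>j. ok j (H j) \<and> H (Suc j) < H j"
      proof (rule dependent_nat_choice)
        show "\<exists>h. ok 0 h" using ok_ex[of 1 0] by auto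
        show "\<exists>h'. ok (Suc j) h' \<and> h' < h" if "ok j h" for h j
          using that by (intro ok_ex) (simp add: ok_def)
      qed
      then obtain H where H: "\<And>j. ok j (H j)" "\<And>j. H (Suc j) < H j" by blast
      have "\<exists>f. microlocalized (A j) (neighbourhood K j) (H j) f \<and> L2_norm f = 1 \<and>
          (\<forall>y\<in>x (H j) ` {1..N (H j)}. f y = 0)" for j
      proof (rule A)
        have "card (x (H j) ` {1..N (H j)}) \<le> N (H j)"
          using card_image_le[of "{1..N (H j)}" "x (H j)"] by simp
        then show "card (x (H j) ` {1..N (H j)}) \<le> V / (2 * pi * H j) ^ CARD('n)"
          using H(1)[of j] by (simp add: ok_def P_def)
      qed (use H(1)[of j] in \<open>auto simp: ok_def\<close>)
      then obtain g where gs: "\<And>j. microlocalized (A j) (neighbourhood K j) (H j) (g j)"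
        "\<And>j. L2_norm (g j) = 1" "\<And>j k. k \<in> {1..N (H j)} \<Longrightarrow> g j (x (H j) k) = 0"
        by (metis imageI)
      interpret concentrating_sequence K H g A
        using assms(3) Kne H gs(1,2) by unfold_locales (auto simp: ok_def less_imp_le)
      obtain r where r: "O_h_infinity r"
        "\<And>h. h \<in> {0<..<h0} \<Longrightarrow> (L2_norm (family h))\<^sup>2 \<le> C * (\<Sum>j=1..N h. (cmod (family h (x h j)))\<^sup>2) + r h"
        using assms(4)[OF band_limited_family WF_h_family] by blast
      have r1: "1 \<le> r (H j)" for j
        using r(2)[of "H j"] H(1)[of j] gs(2,3) by (simp add: ok_def family_H)
      have "r \<in> O[at_right 0](\<lambda>h. h ^ 1)" using r(1) unfolding O_h_infinity_def by blast
      then obtain c where c: "\<forall>\<^sub>F h in at_right 0. norm (r h) \<le> c * \<bar>h\<bar>"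
        by (rule landau_o.bigE) simp
      have "((\<lambda>h. c * \<bar>h\<bar>) \<longlongrightarrow> c * \<bar>0\<bar>) (at_right 0)"
        by (intro tendsto_intros)
      then have "\<forall>\<^sub>F h in at_right 0. c * \<bar>h\<bar> < 1"
        by (rule order_tendstoD(2)) simp
      with c have "\<forall>\<^sub>F h in at_right 0. norm (r h) < 1" by eventually_elim linarith
      then obtain b where b: "b > 0" "\<And>h. 0 < h \<Longrightarrow> h < b \<Longrightarrow> norm (r h) < 1"
        unfolding eventually_at_right_field by auto
      obtain j :: nat where "1 / (real j + 1) < b"
        using reals_Archimedean[OF b(1)] by (auto simp: inverse_eq_divide add.commute)
      then have "norm (r (H j)) < 1" using b(2)[of "H j"] H(1)[of j] by (auto simp: ok_def)
      then show False using r1[of j] by simp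
    qed
    (* The remainder that turns the claim into an equality where the bound fails; it vanishes for
       small h. *)
    define r where "r = (\<lambda>h. if P h then 0 else 1 - N h * (2 * pi * h) ^ CARD('n) / V)"
    have "r \<in> o[at_right 0](\<lambda>h. h) \<longleftrightarrow> (\<lambda>h. 0) \<in> o[at_right 0](\<lambda>h :: real. h)"
      using ev by (intro landau_o.small.in_cong) (auto simp: r_def elim: eventually_mono)
    moreover have "N h \<ge> 1 / (2 * pi * h) ^ CARD('n) * V * (1 - r h)" if "h > 0" for h
      using that V by (auto simp: r_def P_def)
    ultimately show ?thesis by (intro exI[of _ r]) (simp add: V_def)
  qed
qed

end
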